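(* Let $k\ge 2$ be an integer and let $\beta=(A,B,C,D,E,F)$ be a $6$-tuple of pairwise disjoint nonempty finite sets with $k=|C|=|F|=|A\cup B|=|D\cup E|$. Let $M_\beta$ be the matroid on the ground set $A\cup B\cup C\cup D\cup E\cup F$ whose cyclic flats are exactly the following seven sets, with the following ranks: the ground set has rank $2k$; $A\cup B\cup D\cup E$ has rank $2k-1$; $C\cup B\cup E$ has rank $k+|B|$; $C\cup A\cup D$ has rank $k+|A|$; $F\cup E\cup A$ has rank $k+|E|$; $F\cup D\cup B$ has rank $k+|D|$; and $\varnothing$ has rank $0$. Then: (1) $M_\beta$ is neither $k$-base-orderable nor strongly base-orderable; (2) every single-element contraction of $M_\beta$ is transversal; (3) $M_\beta$ is an excluded minor for the class of strongly base-orderable matroids and for the class of $k$-base-orderable matroids; (4) $M_\beta$ is $(k-1)$-base-orderable; and (5) if $|A|=|B|=|D|=|E|=k/2$, then $M_\beta$ has exactly two (unordered) pairs of bases that have no $k$-exchange-ordering; otherwise, there is only one such pair of bases.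
   Context: All matroids are finite. A cyclic flat of a matroid $M$ is a flat that is a (possibly empty) union of circuits. A matroid is determined by its ground set together with its cyclic flats and their ranks: with $\mathcal{Z}(M)$ the set of cyclic flats, $r_M(W)=\min\{r_M(Z)+|W-Z| : Z\in\mathcal{Z}(M)\}$ for all $W\subseteq E(M)$. The given data do define a matroid $M_\beta$. For a positive integer $k$, a $k$-exchange-ordering for a pair of bases $B_1,B_2$ of $M$ is a bijection $\sigma : B_1\to B_2$ such that, for every $X\subseteq B_1$ with $|X|\le k$, both $(B_1-X)\cup\sigma(X)$ and $(B_2-\sigma(X))\cup X$ are bases of $M$ (if $\sigma$ is one, so is $\sigma^{-1}: B_2\to B_1$, so the order of the pair is immaterial). A matroid is $k$-base-orderable if each pair of its bases has a $k$-exchange-ordering. A matroid is strongly base-orderable if for each pair of bases $B_1,B_2$ there is a bijection $\sigma : B_1\to B_2$ such that these two sets are bases for every $X\subseteq B_1$. An excluded minor for a class is a matroid not in the class all of whose proper minors are in the class. *)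

theory Defs
  imports Complex_Main
begin

record 'a matroid_data =
  ground :: "'a set"
  indeps :: "'a set set"

locale matroid =
  fixes M :: "'a matroid_data"
  assumes finite_ground: "finite (ground M)"
    and indep_subset_ground: "X \<in> indeps M \<Longrightarrow> X \<subseteq> ground M"
    and empty_indep: "{} \<in> indeps M"
    and indep_subset: "X \<in> indeps M \<Longrightarrow> Y \<subseteq> X \<Longrightarrow> Y \<in> indeps M"
    and augment: "X \<in> indeps M \<Longrightarrow> Y \<in> indeps M \<Longrightarrow> card X < card Y \<Longrightarrow>
      \<exists>y\<in>Y - X. insert y X \<in> indeps M"

definition bases :: "'a matroid_data \<Rightarrow> 'a set set" where
  "bases M = {B \<in> indeps M. \<forall>X\<in>indeps M. B \<subseteq> X \<longrightarrow> X = B}"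

definition circuits :: "'a matroid_data \<Rightarrow> 'a set set" where
  "circuits M = {C. C \<subseteq> ground M \<and> C \<notin> indeps M \<and> (\<forall>X. X \<subset> C \<longrightarrow> X \<in> indeps M)}"

definition rk :: "'a matroid_data \<Rightarrow> 'a set \<Rightarrow> nat" where
  "rk M W = Max (card ` {X \<in> indeps M. X \<subseteq> W})"

definition flats :: "'a matroid_data \<Rightarrow> 'a set set" where
  "flats M = {F. F \<subseteq> ground M \<and> (\<forall>x \<in> ground M - F. rk M F < rk M (insert x F))}"

definition cyclic_flats :: "'a matroid_data \<Rightarrow> 'a set set" where
  "cyclic_flats M = {Z \<in> flats M. \<exists>\<C> \<subseteq> circuits M. Z = \<Union>\<C>}"

definition delete :: "'a matroid_data \<Rightarrow> 'a set \<Rightarrow> 'a matroid_data" where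
  "delete M X = \<lparr>ground = ground M - X, indeps = {I \<in> indeps M. I \<subseteq> ground M - X}\<rparr>"

(* The rank function of the contraction is Y |-> rk M (Y \<union> X) - rk M X, and a set is
   independent when its rank equals its size; the equation is written without subtraction on nat. *)
definition contract :: "'a matroid_data \<Rightarrow> 'a set \<Rightarrow> 'a matroid_data" where
  "contract M X = \<lparr>ground = ground M - X,
     indeps = {I. I \<subseteq> ground M - X \<and> rk M (I \<union> X) = rk M X + card I}\<rparr>"

definition proper_minor :: "'a matroid_data \<Rightarrow> 'a matroid_data \<Rightarrow> bool" where
  "proper_minor N M \<longleftrightarrow> (\<exists>X Y. X \<subseteq> ground M \<and> Y \<subseteq> ground M \<and> X \<inter> Y = {} \<and>
     X \<union> Y \<noteq> {} \<and> N = delete (contract M X) Y)"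

definition excluded_minor :: "'a matroid_data set \<Rightarrow> 'a matroid_data \<Rightarrow> bool" where
  "excluded_minor \<K> M \<longleftrightarrow> matroid M \<and> M \<notin> \<K> \<and> (\<forall>N. proper_minor N M \<longrightarrow> N \<in> \<K>)"

(* The independent sets are the partial transversals of a finite family S 0, ..., S (n - 1)
   of (not necessarily distinct) subsets of the ground set. *)
definition transversal :: "'a matroid_data \<Rightarrow> bool" where
  "transversal M \<longleftrightarrow> (\<exists>(n::nat) S. (\<forall>j<n. S j \<subseteq> ground M) \<and>
     indeps M = {X. X \<subseteq> ground M \<and> (\<exists>\<phi>. inj_on \<phi> X \<and> (\<forall>x\<in>X. \<phi> x < n \<and> x \<in> S (\<phi> x)))})"

definition exchange_ordering ::
  "nat \<Rightarrow> 'a matroid_data \<Rightarrow> 'a set \<Rightarrow> 'a set \<Rightarrow> ('a \<Rightarrow> 'a) \<Rightarrow> bool" where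
  "exchange_ordering k M B1 B2 \<sigma> \<longleftrightarrow> bij_betw \<sigma> B1 B2 \<and>
     (\<forall>X \<subseteq> B1. card X \<le> k \<longrightarrow>
        (B1 - X) \<union> \<sigma> ` X \<in> bases M \<and> (B2 - \<sigma> ` X) \<union> X \<in> bases M)"

definition base_orderable :: "nat \<Rightarrow> 'a matroid_data set" where
  "base_orderable k = {M. matroid M \<and>
     (\<forall>B1\<in>bases M. \<forall>B2\<in>bases M. \<exists>\<sigma>. exchange_ordering k M B1 B2 \<sigma>)}"

definition strongly_base_orderable :: "'a matroid_data set" where
  "strongly_base_orderable = {M. matroid M \<and>
     (\<forall>B1\<in>bases M. \<forall>B2\<in>bases M. \<exists>\<sigma>. bij_betw \<sigma> B1 B2 \<and>
        (\<forall>X \<subseteq> B1. (B1 - X) \<union> \<sigma> ` X \<in> bases M \<and> (B2 - \<sigma> ` X) \<union> X \<in> bases M))}"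

(* Unordered pairs are represented as sets {B1, B2}; no degenerate pair B1 = B2 occurs,
   since the identity is an exchange-ordering of a basis with itself. *)
definition unorderable_pairs :: "nat \<Rightarrow> 'a matroid_data \<Rightarrow> 'a set set set" where
  "unorderable_pairs k M = {{B1, B2} | B1 B2. B1 \<in> bases M \<and> B2 \<in> bases M \<and>
     \<not> (\<exists>\<sigma>. exchange_ordering k M B1 B2 \<sigma>)}"

(* Distinctness is needed because the set {A, B, C, D, E, F} would hide repeated entries. *)
definition beta_tuple ::
  "nat \<Rightarrow> 'a set \<Rightarrow> 'a set \<Rightarrow> 'a set \<Rightarrow> 'a set \<Rightarrow> 'a set \<Rightarrow> 'a set \<Rightarrow> bool" where
  "beta_tuple k A B C D E F \<longleftrightarrow>
     distinct [A, B, C, D, E, F] \<and> pairwise disjnt {A, B, C, D, E, F} \<and>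
     (\<forall>S\<in>{A, B, C, D, E, F}. finite S \<and> S \<noteq> {}) \<and>
     card C = k \<and> card F = k \<and> card (A \<union> B) = k \<and> card (D \<union> E) = k"

(* A matroid is determined by its ground set, cyclic flats and their ranks, so for a given
   tuple this predicate holds of a single M. *)
definition is_M_beta ::
  "nat \<Rightarrow> 'a set \<Rightarrow> 'a set \<Rightarrow> 'a set \<Rightarrow> 'a set \<Rightarrow> 'a set \<Rightarrow> 'a set \<Rightarrow> 'a matroid_data \<Rightarrow> bool"
where
  "is_M_beta k A B C D E F M \<longleftrightarrow> matroid M \<and>
     ground M = A \<union> B \<union> C \<union> D \<union> E \<union> F \<and>
     cyclic_flats M = {ground M, A \<union> B \<union> D \<union> E, C \<union> B \<union> E, C \<union> A \<union> D, F \<union> E \<union> A, F \<union> D \<union> B, {}} \<and>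
     rk M (ground M) = 2 * k \<and>
     rk M (A \<union> B \<union> D \<union> E) = 2 * k - 1 \<and>
     rk M (C \<union> B \<union> E) = k + card B \<and>
     rk M (C \<union> A \<union> D) = k + card A \<and>
     rk M (F \<union> E \<union> A) = k + card E \<and>
     rk M (F \<union> D \<union> B) = k + card D \<and>
     rk M {} = 0"

end

theory Submission
  imports Defs
begin

text \<open>Write \<open>H = A \<union> B \<union> D \<union> E\<close>. This is a circuit-hyperplane: it has \<open>2 * k\<close> elements and rank
  \<open>2 * k - 1\<close>. A set is independent exactly when it meets no cyclic flat in more elements than the rank
  of that flat (\<open>indep_iff_cyclic_flats\<close>), so independence is a system of linear inequalities between
  the numbers of elements that a set has in the six classes \<open>A\<close>, ..., \<open>F\<close>.

  Contracting one element makes the matroid transversal of rank \<open>2 * k - 1\<close>. A presentation consists of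
  copies of the complements of the cyclic flats; a flat \<open>Z\<close> of \<open>M/x\<close> must miss as many members of the
  family as its rank falls short of \<open>2 * k - 1\<close>, which determines the multiplicities. Hall's theorem
  turns the correctness of the presentation into a few counting inequalities
  (\<open>contract_presentation\<close>).

  Two bases of a transversal matroid that are matched to all members of a family have a strong
  ordering, because elements matched to the same member can be exchanged independently
  (\<open>full_transversals_exchange\<close>). Two intersecting bases of \<open>M\<close> are therefore ordered by contracting a
  common element. Two disjoint bases partition the ground set, which has \<open>4 * k\<close> elements. If they
  split some class, then, since elements of one class are clones, the pair can be replaced by an
  intersecting one (\<open>split_class_ordering\<close>). Otherwise both bases are unions of classes, and the
  inequalities leave only the pair \<open>A \<union> B \<union> C\<close>, \<open>D \<union> E \<union> F\<close> and, when \<open>A\<close>, \<open>B\<close>, \<open>D\<close>, \<open>E\<close> have equal sizes,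
  the pair \<open>C \<union> D \<union> E\<close>, \<open>A \<union> B \<union> F\<close> (\<open>unsplit_pair\<close>), which a symmetry of the matroid turns into the
  first one.

  In the first pair, single exchanges force an ordering to map \<open>A \<union> B\<close> to \<open>F\<close> and \<open>C\<close> to \<open>D \<union> E\<close>. Exchanging
  the \<open>k\<close> elements of \<open>C\<close> then produces \<open>H\<close>, and this is the only obstruction: each such bijection
  is a \<open>(k - 1)\<close>-exchange-ordering. Finally, two bases of a proper minor extend by the same elements
  to two bases of \<open>M\<close> that do not partition the ground set (\<open>minor_lift\<close>). That pair is not
  exceptional, so it has a strong ordering, which restricts to the minor.\<close>

section \<open>Independence, bases and minors\<close>

context matroid
begin

lemma finite_indep: "X \<in> indeps M \<Longrightarrow> finite X"
  using finite_ground finite_subset indep_subset_ground by blast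

lemma finite_indeps: "finite (indeps M)"
  using finite_ground indep_subset_ground by (meson finite_Pow_iff finite_subset PowI subsetI)

lemma card_le_rk: "I \<in> indeps M \<Longrightarrow> I \<subseteq> W \<Longrightarrow> card I \<le> rk M W"
  unfolding rk_def by (rule Max_ge) (auto simp: finite_indeps)

lemma rk_witness: obtains I where "I \<in> indeps M" "I \<subseteq> W" "card I = rk M W"
proof -
  have "rk M W \<in> card ` {X \<in> indeps M. X \<subseteq> W}"
    unfolding rk_def by (rule Max_in) (use finite_indeps empty_indep in auto)
  then show thesis using that by auto
qed

lemma rk_mono: "V \<subseteq> W \<Longrightarrow> rk M V \<le> rk M W"
  by (metis card_le_rk rk_witness subset_trans)

lemma rk_indep: "I \<in> indeps M \<Longrightarrow> rk M I = card I"
  by (metis card_le_rk card_mono finite_indep le_antisym order_refl rk_witness)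

lemma extend_indep:
  assumes "X \<in> indeps M" "Y \<in> indeps M" "card X \<le> card Y"
  obtains Z where "Z \<in> indeps M" "X \<subseteq> Z" "Z \<subseteq> X \<union> Y" "card Z = card Y"
proof -
  have "\<exists>Z\<in>indeps M. X \<subseteq> Z \<and> Z \<subseteq> X \<union> Y \<and> card Z = card Y"
    using assms
  proof (induction "card Y - card X" arbitrary: X)
    case 0
    then show ?case by force
  next
    case (Suc n)
    have "card X < card Y" using Suc.hyps(2) by linarith
    then obtain y where y: "y \<in> Y - X" "insert y X \<in> indeps M"
      using augment Suc.prems by blast
    have "card (insert y X) = Suc (card X)"
      using y finite_indep[OF Suc.prems(1)] by simp
    then have "\<exists>Z\<in>indeps M. insert y X \<subseteq> Z \<and> Z \<subseteq> insert y X \<union> Y \<and> card Z = card Y"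
      using Suc.hyps(2) Suc.prems y \<open>card X < card Y\<close> by (intro Suc.hyps(1)) simp_all
    then show ?case using y by blast
  qed
  then show thesis using that by blast
qed

lemma bases_iff: "B \<in> bases M \<longleftrightarrow> B \<in> indeps M \<and> card B = rk M (ground M)"
proof
  assume B: "B \<in> bases M"
  then have BI: "B \<in> indeps M" by (simp add: bases_def)
  obtain J where J: "J \<in> indeps M" "card J = rk M (ground M)" by (rule rk_witness)
  obtain Z where Z: "Z \<in> indeps M" "B \<subseteq> Z" "card Z = card J"
    using extend_indep[OF BI J(1)] card_le_rk[OF BI indep_subset_ground[OF BI]] J(2) by metis
  then show "B \<in> indeps M \<and> card B = rk M (ground M)"
    using B J(2) BI unfolding bases_def by auto
next
  assume B: "B \<in> indeps M \<and> card B = rk M (ground M)"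
  show "B \<in> bases M"
    unfolding bases_def
  proof (intro CollectI conjI ballI impI)
    fix X assume X: "X \<in> indeps M" "B \<subseteq> X"
    then show "X = B"
      using B card_le_rk[OF X(1) indep_subset_ground] card_subset_eq[of X B] card_mono[of X B]
        finite_indep[OF X(1)] by (metis le_antisym)
  qed (use B in auto)
qed

lemma card_bases: "B1 \<in> bases M \<Longrightarrow> B2 \<in> bases M \<Longrightarrow> card B1 = card B2"
  by (simp add: bases_iff)

lemma dependent_contains_circuit:
  assumes "W \<subseteq> ground M" "W \<notin> indeps M"
  obtains C where "C \<in> circuits M" "C \<subseteq> W"
proof -
  have "finite W" using assms(1) finite_ground finite_subset by blast
  then have "\<exists>C\<in>circuits M. C \<subseteq> W"
    using assms
  proof (induction W rule: finite_psubset_induct)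
    case (psubset W)
    show ?case
    proof (cases "\<forall>X. X \<subset> W \<longrightarrow> X \<in> indeps M")
      case True
      then show ?thesis using psubset.prems by (auto simp: circuits_def)
    next
      case False
      then obtain X where "X \<subset> W" "X \<notin> indeps M" by blast
      then show ?thesis using psubset.IH[of X] psubset.prems(1) by blast
    qed
  qed
  then show thesis using that by blast
qed

text \<open>A dependent set meets some cyclic flat in too many elements because the closure of a circuit
  \<open>C\<close> is a cyclic flat: its rank is \<open>card C - 1\<close>, and each element outside \<open>C\<close> that it contains
  closes a circuit with elements of \<open>C\<close>. So the cyclic flats and their ranks determine the matroid.\<close>

lemma indep_iff_cyclic_flats:
  "W \<in> indeps M \<longleftrightarrow> W \<subseteq> ground M \<and> (\<forall>Z\<in>cyclic_flats M. card (W \<inter> Z) \<le> rk M Z)"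
proof
  assume "W \<in> indeps M"
  then show "W \<subseteq> ground M \<and> (\<forall>Z\<in>cyclic_flats M. card (W \<inter> Z) \<le> rk M Z)"
    by (meson card_le_rk indep_subset indep_subset_ground inf_le1 inf_le2)
next
  assume W: "W \<subseteq> ground M \<and> (\<forall>Z\<in>cyclic_flats M. card (W \<inter> Z) \<le> rk M Z)"
  show "W \<in> indeps M"
  proof (rule ccontr)
    assume "W \<notin> indeps M"
    then obtain C where C: "C \<in> circuits M" "C \<subseteq> W"
      using W dependent_contains_circuit by blast
    have Cg: "C \<subseteq> ground M" and Cd: "C \<notin> indeps M"
      and Cmin: "\<And>X. X \<subset> C \<Longrightarrow> X \<in> indeps M"
      using C(1) by (auto simp: circuits_def)
    obtain c where c: "c \<in> C" using Cd empty_indep by (metis all_not_in_conv)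
    define I where "I = C - {c}"
    have "I \<subset> C" using c by (auto simp: I_def)
    then have I: "I \<in> indeps M" by (rule Cmin)
    have cardC: "card C = Suc (card I)"
      unfolding I_def using c Cg finite_ground finite_subset by (metis card.remove)
    define Z where "Z = {z \<in> ground M. z \<in> I \<or> insert z I \<notin> indeps M}"
    have IZ: "I \<subseteq> Z" using indep_subset_ground[OF I] by (auto simp: Z_def)
    have CZ: "C \<subseteq> Z"
    proof
      fix z assume "z \<in> C"
      moreover have "insert c I = C" using c by (auto simp: I_def)
      ultimately show "z \<in> Z" using Cd Cg by (cases "z = c") (auto simp: Z_def I_def)
    qed
    have rkZ: "rk M Z = card I"
    proof (rule antisym)
      obtain J where J: "J \<in> indeps M" "J \<subseteq> Z" "card J = rk M Z" by (rule rk_witness)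
      show "rk M Z \<le> card I"
      proof (rule ccontr)
        assume "\<not> rk M Z \<le> card I"
        then obtain y where "y \<in> J - I" "insert y I \<in> indeps M"
          using augment[OF I J(1)] J(3) by auto
        then show False using J(2) by (auto simp: Z_def)
      qed
    qed (use I IZ card_le_rk in blast)
    have flat: "Z \<in> flats M"
      unfolding flats_def
    proof (intro CollectI conjI ballI)
      fix x assume x: "x \<in> ground M - Z"
      then have "insert x I \<in> indeps M" "x \<notin> I" by (auto simp: Z_def)
      then have "Suc (card I) \<le> rk M (insert x Z)"
        using card_le_rk[of "insert x I" "insert x Z"] IZ finite_indep[OF I] by auto
      then show "rk M Z < rk M (insert x Z)" using rkZ by simp
    qed (auto simp: Z_def)
    have "\<exists>D\<in>circuits M. D \<subseteq> Z \<and> z \<in> D" if z: "z \<in> Z" for z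
    proof (cases "z \<in> C")
      case True
      then show ?thesis using C(1) CZ by blast
    next
      case False
      then have "insert z I \<notin> indeps M" "z \<in> ground M" using z by (auto simp: Z_def I_def)
      then obtain D where D: "D \<in> circuits M" "D \<subseteq> insert z I"
        using dependent_contains_circuit indep_subset_ground[OF I] by (metis insert_subset)
      have "z \<in> D"
      proof (rule ccontr)
        assume "z \<notin> D"
        then have "D \<subseteq> I" using D(2) by blast
        then show False using D(1) I indep_subset by (auto simp: circuits_def)
      qed
      then show ?thesis using D z IZ by blast
    qed
    then have "Z = \<Union>{D \<in> circuits M. D \<subseteq> Z}" by blast
    then have "\<exists>\<C>\<subseteq>circuits M. Z = \<Union>\<C>" by (metis (no_types) Collect_subset)
    then have "Z \<in> cyclic_flats M" using flat by (simp add: cyclic_flats_def)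
    then have "card (W \<inter> Z) \<le> card I" using W rkZ by auto
    moreover have "card C \<le> card (W \<inter> Z)"
      using C(2) CZ W finite_ground by (intro card_mono) (auto intro: finite_subset)
    ultimately show False using cardC by simp
  qed
qed

text \<open>The definition of contraction by ranks agrees with the one that adds a basis \<open>I0\<close> of the contracted
  set.\<close>

lemma contract_indeps:
  assumes "X \<subseteq> ground M" "I0 \<in> indeps M" "I0 \<subseteq> X" "card I0 = rk M X"
  shows "indeps (contract M X) = {I. I \<subseteq> ground M - X \<and> I \<union> I0 \<in> indeps M}"
proof -
  have "rk M (I \<union> X) = rk M X + card I \<longleftrightarrow> I \<union> I0 \<in> indeps M"
    if I: "I \<subseteq> ground M - X" for I
  proof -
    have fI: "finite I" "finite I0"
      using I finite_ground finite_subset finite_indep[OF assms(2)] by blast+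
    have disj: "I \<inter> I0 = {}" using I assms(3) by blast
    have cardU: "card (I \<union> I0) = rk M X + card I"
      using card_Un_disjoint[OF fI disj] assms(4) by simp
    obtain J where J: "J \<in> indeps M" "J \<subseteq> I \<union> X" "card J = rk M (I \<union> X)" by (rule rk_witness)
    have "rk M X \<le> rk M (I \<union> X)" by (rule rk_mono) simp
    then obtain L where L: "L \<in> indeps M" "I0 \<subseteq> L" "L \<subseteq> I0 \<union> J" "card L = rk M (I \<union> X)"
      using extend_indep[OF assms(2) J(1)] J(3) assms(4) by metis
    have LX: "L \<inter> X = I0"
    proof (rule card_subset_eq[symmetric])
      show "finite (L \<inter> X)" using finite_indep[OF L(1)] by simp
      show "I0 \<subseteq> L \<inter> X" using L(2) assms(3) by blast
      have "card (L \<inter> X) \<le> rk M X" using L(1) indep_subset card_le_rk by (meson inf_le1 inf_le2)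
      then show "card I0 = card (L \<inter> X)"
        using card_mono[OF \<open>finite (L \<inter> X)\<close> \<open>I0 \<subseteq> L \<inter> X\<close>] assms(4) by simp
    qed
    have LI: "L \<subseteq> I \<union> I0" using LX L(3) J(2) by blast
    show ?thesis
    proof
      assume "rk M (I \<union> X) = rk M X + card I"
      then have "L = I \<union> I0"
        using LI L(4) cardU fI by (intro card_subset_eq) auto
      then show "I \<union> I0 \<in> indeps M" using L(1) by simp
    next
      assume "I \<union> I0 \<in> indeps M"
      then have "card (I \<union> I0) \<le> rk M (I \<union> X)" using assms(3) by (intro card_le_rk) auto
      moreover have "card L \<le> card (I \<union> I0)" using LI fI by (intro card_mono) auto
      ultimately show "rk M (I \<union> X) = rk M X + card I" using cardU L(4) by simp
    qed
  qed
  then show ?thesis unfolding contract_def by auto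
qed

text \<open>The bases of a minor are the traces of the bases of \<open>M\<close> that contain a fixed set \<open>K\<close> of removed
  elements and no other removed element. For a contraction of \<open>X\<close> and a deletion of \<open>Y\<close> one takes \<open>K\<close>
  to be a basis of \<open>X\<close> and as many elements of \<open>Y\<close> as one base needs to become a base of \<open>M\<close>; any
  other base of the minor is completed by the same elements, because it already spans what the
  elements of the first base could add.\<close>

lemma minor_lift:
  assumes "proper_minor N M"
  obtains K where "matroid N" "ground N \<subset> ground M" "K \<subseteq> ground M - ground N"
    "\<And>P. P \<in> bases N \<longleftrightarrow> P \<subseteq> ground N \<and> P \<union> K \<in> bases M"
proof -
  obtain X Y where XY: "X \<subseteq> ground M" "Y \<subseteq> ground M" "X \<inter> Y = {}" "X \<union> Y \<noteq> {}"
    and N: "N = delete (contract M X) Y"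
    using assms by (auto simp: proper_minor_def)
  obtain I0 where I0: "I0 \<in> indeps M" "I0 \<subseteq> X" "card I0 = rk M X" by (rule rk_witness)
  have gN: "ground N = ground M - (X \<union> Y)"
    by (auto simp: N delete_def contract_def)
  have iN: "I \<in> indeps N \<longleftrightarrow> I \<subseteq> ground N \<and> I \<union> I0 \<in> indeps M" for I
  proof -
    have "indeps N = {I \<in> indeps (contract M X). I \<subseteq> ground N}"
      by (auto simp: N delete_def contract_def)
    then show ?thesis using contract_indeps[OF XY(1) I0] gN by auto
  qed
  have disj0: "I \<inter> I0 = {}" if "I \<subseteq> ground N" for I using that gN I0(2) by blast
  have cardI0: "card (I \<union> I0) = card I + card I0" if "I \<in> indeps N" for I
    using that disj0[of I] iN finite_indep[of "I \<union> I0"] by (simp add: card_Un_disjoint)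
  have matN: "matroid N"
  proof
    show "finite (ground N)" using gN finite_ground by simp
    show "X \<subseteq> ground N" if "X \<in> indeps N" for X using that iN by simp
    show "{} \<in> indeps N" using iN I0(1) by simp
    show "Y \<in> indeps N" if "X \<in> indeps N" "Y \<subseteq> X" for X Y
      using that iN indep_subset[of "X \<union> I0" "Y \<union> I0"] by blast
    show "\<exists>y\<in>Y - X. insert y X \<in> indeps N"
      if XY: "X \<in> indeps N" "Y \<in> indeps N" "card X < card Y" for X Y
    proof -
      have "card (X \<union> I0) < card (Y \<union> I0)" using XY cardI0 by simp
      then obtain y where "y \<in> (Y \<union> I0) - (X \<union> I0)" "insert y (X \<union> I0) \<in> indeps M"
        using augment[of "X \<union> I0" "Y \<union> I0"] XY iN by blast
      then show ?thesis using XY iN by (intro bexI[of _ y]) auto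
    qed
  qed
  interpret N: matroid N by (rule matN)
  obtain P0 where P0: "P0 \<in> indeps N" "card P0 = rk N (ground N)" by (rule N.rk_witness)
  obtain B where B: "B \<in> indeps M" "card B = rk M (ground M)" by (rule rk_witness)
  have P0I: "P0 \<union> I0 \<in> indeps M" using P0(1) iN by simp
  have "card (P0 \<union> I0) \<le> card B" using B(2) P0I card_le_rk indep_subset_ground by metis
  then obtain Z where Z: "Z \<in> indeps M" "P0 \<union> I0 \<subseteq> Z" "card Z = card B"
    using extend_indep[OF P0I B(1)] by metis
  define K where "K = Z - P0"
  have I0K: "I0 \<subseteq> K" using Z(2) disj0[of P0] P0(1) iN by (auto simp: K_def)
  have P0K: "P0 \<inter> K = {}" "P0 \<union> K = Z" using Z(2) by (auto simp: K_def)
  \<comment> \<open>An element of \<open>Z\<close> outside \<open>P0\<close> that survives in the minor would enlarge the base \<open>P0\<close>.\<close>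
  have K: "K \<subseteq> ground M - ground N"
  proof
    fix z assume z: "z \<in> K"
    have "z \<notin> ground N"
    proof
      assume "z \<in> ground N"
      moreover have "insert z P0 \<union> I0 \<in> indeps M"
        using indep_subset[OF Z(1)] z Z(2) by (auto simp: K_def)
      ultimately have "insert z P0 \<in> indeps N" using iN P0(1) by simp
      then have "card (insert z P0) \<le> card P0"
        using N.card_le_rk N.indep_subset_ground P0(2) by metis
      then show False using z N.finite_indep[OF P0(1)] by (auto simp: K_def)
    qed
    then show "z \<in> ground M - ground N" using z indep_subset_ground[OF Z(1)] by (auto simp: K_def)
  qed
  have finK: "finite K" using finite_indep[OF Z(1)] by (simp add: K_def)
  have cardK: "card (P \<union> K) = card P + card K" if "P \<subseteq> ground N" for P
    using that K finK N.finite_ground finite_subset by (intro card_Un_disjoint) blast+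
  have rkM: "rk M (ground M) = rk N (ground N) + card K"
    using cardK[of P0] P0 iN P0K(2) Z(3) B(2) by simp
  have bases: "P \<in> bases N \<longleftrightarrow> P \<subseteq> ground N \<and> P \<union> K \<in> bases M" for P
  proof
    assume "P \<in> bases N"
    then have P: "P \<in> indeps N" "card P = rk N (ground N)" by (simp_all add: N.bases_iff)
    have Pg: "P \<subseteq> ground N" using P(1) iN by simp
    have PI: "P \<union> I0 \<in> indeps M" using P(1) iN by simp
    have "card (P \<union> I0) \<le> card Z" using PI card_le_rk indep_subset_ground Z(3) B(2) by metis
    then obtain L where L: "L \<in> indeps M" "P \<union> I0 \<subseteq> L" "L \<subseteq> P \<union> I0 \<union> Z" "card L = card Z"
      using extend_indep[OF PI Z(1)] by metis
    have "L \<inter> ground N \<subseteq> P"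
    proof
      fix z assume z: "z \<in> L \<inter> ground N"
      show "z \<in> P"
      proof (rule ccontr)
        assume "z \<notin> P"
        have "insert z P \<union> I0 \<in> indeps M" using indep_subset[OF L(1)] z L(2) by auto
        then have "insert z P \<in> indeps N" using iN z Pg by simp
        then have "card (insert z P) \<le> card P"
          using N.card_le_rk N.indep_subset_ground P(2) by metis
        then show False using \<open>z \<notin> P\<close> N.finite_indep[OF P(1)] by simp
      qed
    qed
    then have "L \<subseteq> P \<union> K" using L(3) I0K P0K P0(1) iN by blast
    then have "L = P \<union> K"
      using L(4) cardK[OF Pg] P(2) rkM Z(3) B(2) finK N.finite_indep[OF P(1)]
      by (intro card_subset_eq) auto
    then show "P \<subseteq> ground N \<and> P \<union> K \<in> bases M"
      using Pg L(1,4) Z(3) B(2) by (simp add: bases_iff)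
  next
    assume P: "P \<subseteq> ground N \<and> P \<union> K \<in> bases M"
    then have "P \<union> I0 \<in> indeps M"
      by (meson I0K bases_iff indep_subset subset_refl Un_mono)
    then show "P \<in> bases N" using P iN cardK[of P] rkM by (simp add: N.bases_iff bases_iff)
  qed
  have "ground N \<subset> ground M" using gN XY by blast
  then show thesis using that matN K bases by blast
qed

end


section \<open>Transversals\<close>

text \<open>Hall's marriage theorem, by the argument of Halmos and Vaughan: if every nonempty proper subset
  has a neighbour to spare, match one element arbitrarily; otherwise a tight subset \<open>J\<close> and its
  complement can be matched separately, the latter avoiding the neighbours of \<open>J\<close>.\<close>

lemma Hall_marriage:
  fixes N :: "'a \<Rightarrow> 'b set"
  assumes "finite X" "\<And>x. x \<in> X \<Longrightarrow> finite (N x)"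
    and "\<And>J. J \<subseteq> X \<Longrightarrow> card J \<le> card (\<Union>x\<in>J. N x)"
  shows "\<exists>\<phi>. inj_on \<phi> X \<and> (\<forall>x\<in>X. \<phi> x \<in> N x)"
  using assms
proof (induction "card X" arbitrary: X N rule: less_induct)
  case less
  have finJ: "finite J" if "J \<subseteq> X" for J using that less.prems(1) finite_subset by blast
  have finU: "finite (\<Union>x\<in>J. N x)" if "J \<subseteq> X" for J
    using finJ[OF that] less.prems(2) that by (intro finite_UN_I) auto
  show ?case
  proof (cases "\<exists>J. J \<subset> X \<and> J \<noteq> {} \<and> card (\<Union>x\<in>J. N x) = card J")
    case True
    then obtain J where J: "J \<subset> X" "J \<noteq> {}" "card (\<Union>x\<in>J. N x) = card J" by blast
    let ?U = "\<Union>x\<in>J. N x"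
    have "card J < card X" using J(1) less.prems(1) by (simp add: psubset_card_mono)
    then have "\<exists>\<phi>. inj_on \<phi> J \<and> (\<forall>x\<in>J. \<phi> x \<in> N x)"
      using J(1) less.prems finJ by (intro less.hyps) auto
    then obtain \<phi>1 where \<phi>1: "inj_on \<phi>1 J" "\<forall>x\<in>J. \<phi>1 x \<in> N x" by blast
    have "card (X - J) < card X"
      using J less.prems(1) by (intro psubset_card_mono) auto
    then have "\<exists>\<phi>. inj_on \<phi> (X - J) \<and> (\<forall>x\<in>X - J. \<phi> x \<in> N x - ?U)"
    proof (rule less.hyps)
      fix L assume L: "L \<subseteq> X - J"
      have LJ: "L \<union> J \<subseteq> X" using L J(1) by blast
      have "card L + card J = card (L \<union> J)"
        using L finJ LJ by (intro card_Un_disjoint[symmetric]) auto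
      also have "\<dots> \<le> card (\<Union>x\<in>L \<union> J. N x)" using less.prems(3)[OF LJ] .
      also have "(\<Union>x\<in>L \<union> J. N x) = (\<Union>x\<in>L. N x - ?U) \<union> ?U" by blast
      also have "card \<dots> \<le> card (\<Union>x\<in>L. N x - ?U) + card ?U" by (rule card_Un_le)
      finally show "card L \<le> card (\<Union>x\<in>L. N x - ?U)" using J(3) by simp
    qed (use less.prems in auto)
    then obtain \<phi>2 where \<phi>2: "inj_on \<phi>2 (X - J)" "\<forall>x\<in>X - J. \<phi>2 x \<in> N x - ?U" by blast
    let ?\<phi> = "\<lambda>x. if x \<in> J then \<phi>1 x else \<phi>2 x"
    have "inj_on ?\<phi> X"
    proof (rule inj_onI)
      fix x y assume xy: "x \<in> X" "y \<in> X" "?\<phi> x = ?\<phi> y"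
      have cross: "\<phi>1 s \<noteq> \<phi>2 t" if "s \<in> J" "t \<in> X - J" for s t
      proof -
        have "\<phi>1 s \<in> ?U" using \<phi>1(2) that(1) by blast
        moreover have "\<phi>2 t \<notin> ?U" using \<phi>2(2) that(2) by blast
        ultimately show ?thesis by metis
      qed
      show "x = y"
      proof (cases "x \<in> J"; cases "y \<in> J")
        assume "x \<in> J" "y \<in> J"
        then show ?thesis using xy(3) inj_onD[OF \<phi>1(1), of x y] by simp
      next
        assume "x \<in> J" "y \<notin> J"
        then show ?thesis using xy cross[of x y] by simp
      next
        assume "x \<notin> J" "y \<in> J"
        then show ?thesis using xy cross[of y x] by simp
      next
        assume "x \<notin> J" "y \<notin> J"
        then show ?thesis using xy inj_onD[OF \<phi>2(1), of x y] by simp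
      qed
    qed
    moreover have "\<forall>x\<in>X. ?\<phi> x \<in> N x" using \<phi>1(2) \<phi>2(2) by auto
    ultimately show ?thesis by blast
  next
    case False
    show ?thesis
    proof (cases "X = {}")
      case True
      then show ?thesis by auto
    next
      case ne: False
      then obtain x where x: "x \<in> X" by blast
      have "N x \<noteq> {}" using less.prems(3)[of "{x}"] x by auto
      then obtain j where j: "j \<in> N x" by blast
      have "card (X - {x}) < card X" using less.prems(1) x by (rule card_Diff1_less)
      then have "\<exists>\<phi>. inj_on \<phi> (X - {x}) \<and> (\<forall>y\<in>X - {x}. \<phi> y \<in> N y - {j})"
      proof (rule less.hyps)
        fix L assume L: "L \<subseteq> X - {x}"
        show "card L \<le> card (\<Union>y\<in>L. N y - {j})"
        proof (cases "L = {}")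
          case False
          have LX: "L \<subset> X" using L x by blast
          then have "card L \<noteq> card (\<Union>y\<in>L. N y)"
            using \<open>\<nexists>J. J \<subset> X \<and> J \<noteq> {} \<and> card (\<Union>x\<in>J. N x) = card J\<close> False by metis
          then have "card L < card (\<Union>y\<in>L. N y)" using less.prems(3)[of L] LX by (metis le_neq_implies_less psubset_imp_subset)
          moreover have "card (\<Union>y\<in>L. N y) \<le> Suc (card ((\<Union>y\<in>L. N y) - {j}))"
            using diff_card_le_card_Diff[of "{j}" "\<Union>y\<in>L. N y"] by simp
          ultimately have "card L \<le> card ((\<Union>y\<in>L. N y) - {j})" by linarith
          moreover have "(\<Union>y\<in>L. N y - {j}) = (\<Union>y\<in>L. N y) - {j}" by blast
          ultimately show ?thesis by simp
        qed simp
      qed (use less.prems in auto)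
      then obtain \<phi> where \<phi>: "inj_on \<phi> (X - {x})" "\<forall>y\<in>X - {x}. \<phi> y \<in> N y - {j}" by blast
      have "inj_on (\<phi>(x := j)) X"
        using \<phi> x by (auto simp: inj_on_def)
      moreover have "\<forall>y\<in>X. (\<phi>(x := j)) y \<in> N y" using \<phi>(2) j by auto
      ultimately show ?thesis by blast
    qed
  qed
qed

definition partial_transversal :: "'a set list \<Rightarrow> 'a set \<Rightarrow> bool" where
  "partial_transversal Ss X \<longleftrightarrow>
     (\<exists>\<phi>. inj_on \<phi> X \<and> (\<forall>x\<in>X. \<phi> x < length Ss \<and> x \<in> Ss ! \<phi> x))"

lemma transversalI:
  assumes "\<And>S. S \<in> set Ss \<Longrightarrow> S \<subseteq> ground M"
    and "\<And>X. X \<in> indeps M \<longleftrightarrow> X \<subseteq> ground M \<and> partial_transversal Ss X"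
  shows "transversal M"
  unfolding transversal_def
  using assms by (intro exI[of _ "length Ss"] exI[of _ "(!) Ss"]) (auto simp: partial_transversal_def)

text \<open>Counting by a filter makes Hall's condition computable for families with repeated members.\<close>

lemma partial_transversal_iff_Hall:
  assumes "finite X"
  shows "partial_transversal Ss X \<longleftrightarrow>
    (\<forall>J\<subseteq>X. card J \<le> length (filter (\<lambda>S. S \<inter> J \<noteq> {}) Ss))"
proof -
  define N where "N x = {j. j < length Ss \<and> x \<in> Ss ! j}" for x
  have U: "(\<Union>x\<in>J. N x) = {j. j < length Ss \<and> Ss ! j \<inter> J \<noteq> {}}" for J
    by (auto simp: N_def)
  have cardU: "card (\<Union>x\<in>J. N x) = length (filter (\<lambda>S. S \<inter> J \<noteq> {}) Ss)" for J
    unfolding U length_filter_conv_card ..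
  show ?thesis
  proof
    assume "partial_transversal Ss X"
    then obtain \<phi> where \<phi>: "inj_on \<phi> X" "\<forall>x\<in>X. \<phi> x \<in> N x"
      by (auto simp: partial_transversal_def N_def)
    show "\<forall>J\<subseteq>X. card J \<le> length (filter (\<lambda>S. S \<inter> J \<noteq> {}) Ss)"
    proof (intro allI impI)
      fix J assume J: "J \<subseteq> X"
      have "card J \<le> card (\<Union>x\<in>J. N x)"
      proof (rule card_inj_on_le)
        show "inj_on \<phi> J" using \<phi>(1) J by (rule inj_on_subset)
        show "\<phi> ` J \<subseteq> (\<Union>x\<in>J. N x)" using \<phi>(2) J by blast
        show "finite (\<Union>x\<in>J. N x)" unfolding U by simp
      qed
      then show "card J \<le> length (filter (\<lambda>S. S \<inter> J \<noteq> {}) Ss)" by (simp only: cardU)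
    qed
  next
    assume H: "\<forall>J\<subseteq>X. card J \<le> length (filter (\<lambda>S. S \<inter> J \<noteq> {}) Ss)"
    have "\<exists>\<phi>. inj_on \<phi> X \<and> (\<forall>x\<in>X. \<phi> x \<in> N x)"
    proof (rule Hall_marriage)
      show "card J \<le> card (\<Union>x\<in>J. N x)" if "J \<subseteq> X" for J
        unfolding cardU using H that by simp
    qed (use assms in \<open>simp_all add: N_def\<close>)
    then show "partial_transversal Ss X" by (auto simp: partial_transversal_def N_def)
  qed
qed

text \<open>An ordering of two bases has to fix their common elements. A bijection \<open>g\<close> that moves a common
  element \<open>x\<close>, say \<open>w \<mapsto> x \<mapsto> z\<close>, can be shortcut to \<open>w \<mapsto> z\<close>, \<open>x \<mapsto> x\<close>. Whatever the new bijection produces from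
  \<open>X\<close>, \<open>g\<close> produces without a collision if \<open>x\<close> is exchanged exactly when \<open>w\<close> is. Repeating this fixes
  all common elements.\<close>

lemma untangle_bij:
  assumes "finite P1" "bij_betw g P1 P2"
    and "\<And>X. X \<subseteq> P1 \<Longrightarrow> (P1 - X) \<inter> g ` X = {} \<Longrightarrow> Q ((P1 - X) \<union> g ` X)"
  shows "\<exists>\<sigma>. bij_betw \<sigma> P1 P2 \<and> (\<forall>x \<in> P1 \<inter> P2. \<sigma> x = x) \<and>
    (\<forall>X\<subseteq>P1. Q ((P1 - X) \<union> \<sigma> ` X))"
  using assms
proof (induction "card {x \<in> P1 \<inter> P2. g x \<noteq> x}" arbitrary: g rule: less_induct)
  case less
  have inj: "inj_on g P1" and img: "g ` P1 = P2" using less.prems(2) by (auto simp: bij_betw_def)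
  show ?case
  proof (cases "\<exists>x \<in> P1 \<inter> P2. g x \<noteq> x")
    case False
    have "(P1 - X) \<inter> g ` X = {}" if X: "X \<subseteq> P1" for X
    proof (rule ccontr)
      assume "(P1 - X) \<inter> g ` X \<noteq> {}"
      then obtain x where x: "x \<in> X" "g x \<in> P1" "g x \<notin> X" by blast
      then have "g (g x) = g x" using False img X by blast
      then show False using inj x X by (metis inj_onD subsetD)
    qed
    then have "\<forall>X\<subseteq>P1. Q ((P1 - X) \<union> g ` X)" using less.prems(3) by simp
    moreover have "\<forall>x \<in> P1 \<inter> P2. g x = x" using False by simp
    ultimately show ?thesis using less.prems(2) by (intro exI[of _ g] conjI)
  next
    case True
    then obtain x where x: "x \<in> P1" "x \<in> P2" "g x \<noteq> x" by blast
    then obtain w where w: "w \<in> P1" "g w = x" using img by blast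
    have wx: "w \<noteq> x" using w(2) x(3) by blast
    define \<tau> where "\<tau> z = (if z = w then x else if z = x then w else z)" for z
    define h where "h = g \<circ> \<tau>"
    have hw: "h w = g x" and hx: "h x = x" using w(2) by (auto simp: h_def \<tau>_def)
    have hz: "h z = g z" if "z \<noteq> w" "z \<noteq> x" for z using that by (simp add: h_def \<tau>_def)
    have gx: "g z \<noteq> x" if "z \<in> P1" "z \<noteq> w" for z
      using inj_onD[OF inj _ that(1) w(1)] that(2) w(2) by metis
    have bij: "bij_betw h P1 P2"
      unfolding h_def
    proof (rule bij_betw_trans)
      show "bij_betw \<tau> P1 P1"
        by (rule bij_betw_byWitness[where f' = \<tau>]) (auto simp: \<tau>_def w(1) x(1))
    qed (rule less.prems(2))
    have swap: "Q ((P1 - X) \<union> h ` X)" if X: "X \<subseteq> P1" "(P1 - X) \<inter> h ` X = {}" for X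
    proof -
      define X' where "X' = (if w \<in> X then insert x X else X - {x})"
      have X': "X' \<subseteq> P1" using X(1) x(1) by (auto simp: X'_def)
      define R where "R = g ` (X - {w, x})"
      define H where "H = h ` X"
      have hX: "h ` (X - {w, x}) = R" unfolding R_def using hz by (intro image_cong) auto
      have xR: "x \<notin> R" unfolding R_def using gx X(1) by blast
      have disj: "(P1 - X) \<inter> H = {}" using X(2) by (simp add: H_def)
      have eq: "(P1 - X') \<union> g ` X' = (P1 - X) \<union> H \<and> (P1 - X') \<inter> g ` X' = {}"
      proof (cases "w \<in> X")
        case True
        have "X' = insert w (insert x (X - {w, x}))" using True by (auto simp: X'_def)
        then have e1: "g ` X' = insert x (insert (g x) R)" using w(2) R_def by (metis image_insert)
        have hXR: "H - {x} = insert (g x) R"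
        proof -
          have "X = insert w (X \<inter> {x} \<union> (X - {w, x}))" using True by blast
          then have "H = h ` insert w (X \<inter> {x} \<union> (X - {w, x}))" unfolding H_def by (rule arg_cong)
          then have "H = insert (g x) (h ` (X \<inter> {x}) \<union> R)"
            by (simp only: image_insert image_Un hw hX)
          moreover have "h ` (X \<inter> {x}) \<subseteq> {x}" using hx by auto
          ultimately show ?thesis using x(3) xR by (auto simp: subset_singleton_iff)
        qed
        have e2: "P1 - X' = P1 - X - {x}" using True by (auto simp: X'_def)
        have "x \<in> (P1 - X) \<union> H" using x(1) imageI[of x X h] hx H_def by auto
        then show ?thesis unfolding e1 e2 hXR[symmetric] using disj by blast
      next
        case False
        have "X' = X - {w, x}" using False by (auto simp: X'_def)
        then have e1: "g ` X' = R" by (simp add: R_def)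
        have hXR: "H - {x} = R"
        proof -
          have "X = X \<inter> {x} \<union> (X - {w, x})" using False by blast
          then have "H = h ` (X \<inter> {x}) \<union> R" using hX by (metis H_def image_Un)
          moreover have "h ` (X \<inter> {x}) \<subseteq> {x}" using hx by auto
          ultimately show ?thesis using xR by (auto simp: subset_singleton_iff)
        qed
        have e2: "P1 - X' = insert x (P1 - X)" using False x(1) by (auto simp: X'_def)
        have "x \<in> (P1 - X) \<union> H" using x(1) imageI[of x X h] hx H_def by auto
        then show ?thesis unfolding e1 e2 hXR[symmetric] using disj by blast
      qed
      show ?thesis using less.prems(3)[OF X'] eq by (simp add: H_def)
    qed
    have "{z \<in> P1 \<inter> P2. h z \<noteq> z} \<subset> {z \<in> P1 \<inter> P2. g z \<noteq> z}"
    proof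
      show "{z \<in> P1 \<inter> P2. h z \<noteq> z} \<subseteq> {z \<in> P1 \<inter> P2. g z \<noteq> z}"
      proof
        fix z assume "z \<in> {z \<in> P1 \<inter> P2. h z \<noteq> z}"
        then show "z \<in> {z \<in> P1 \<inter> P2. g z \<noteq> z}"
          using hx hz[of z] w(2) wx by (cases "z = w"; cases "z = x") simp_all
      qed
      show "{z \<in> P1 \<inter> P2. h z \<noteq> z} \<noteq> {z \<in> P1 \<inter> P2. g z \<noteq> z}" using x hx by blast
    qed
    then have "card {z \<in> P1 \<inter> P2. h z \<noteq> z} < card {z \<in> P1 \<inter> P2. g z \<noteq> z}"
      using less.prems(1) by (intro psubset_card_mono) auto
    then show ?thesis by (rule less.hyps[OF _ less.prems(1) bij swap])
  qed
qed

text \<open>If \<open>\<phi>1\<close> and \<open>\<phi>2\<close> match two bases to all members of the family, elements matched to the same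
  member can be exchanged independently: \<open>\<phi>1\<close> on the elements kept and \<open>\<phi>2\<close> on the new ones is again
  a matching.\<close>

lemma full_transversals_exchange:
  assumes "partial_transversal Ss P1" "partial_transversal Ss P2"
    and "finite P1" "finite P2" "card P1 = length Ss" "card P2 = length Ss"
  shows "\<exists>\<sigma>. bij_betw \<sigma> P1 P2 \<and> (\<forall>x \<in> P1 \<inter> P2. \<sigma> x = x) \<and>
    (\<forall>X\<subseteq>P1. partial_transversal Ss ((P1 - X) \<union> \<sigma> ` X))"
proof -
  obtain \<phi>1 where \<phi>1: "inj_on \<phi>1 P1" "\<forall>x\<in>P1. \<phi>1 x < length Ss \<and> x \<in> Ss ! \<phi>1 x"
    using assms(1) by (auto simp: partial_transversal_def)
  obtain \<phi>2 where \<phi>2: "inj_on \<phi>2 P2" "\<forall>x\<in>P2. \<phi>2 x < length Ss \<and> x \<in> Ss ! \<phi>2 x"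
    using assms(2) by (auto simp: partial_transversal_def)
  have "\<phi>1 ` P1 = {..<length Ss}"
    using \<phi>1 assms(5) by (intro card_subset_eq) (auto simp: card_image)
  then have b1: "bij_betw \<phi>1 P1 {..<length Ss}" using \<phi>1(1) by (simp add: bij_betw_def)
  have "\<phi>2 ` P2 = {..<length Ss}"
    using \<phi>2 assms(6) by (intro card_subset_eq) (auto simp: card_image)
  then have b2: "bij_betw \<phi>2 P2 {..<length Ss}" using \<phi>2(1) by (simp add: bij_betw_def)
  define g where "g = inv_into P2 \<phi>2 \<circ> \<phi>1"
  have g: "bij_betw g P1 P2"
    unfolding g_def using b1 bij_betw_inv_into[OF b2] by (rule bij_betw_trans)
  have \<phi>2g: "\<phi>2 (g x) = \<phi>1 x" if "x \<in> P1" for x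
  proof -
    have "\<phi>1 x \<in> \<phi>2 ` P2" using that b1 b2 by (auto simp: bij_betw_def)
    then show ?thesis unfolding g_def by (simp add: f_inv_into_f)
  qed
  show ?thesis
  proof (rule untangle_bij[OF assms(3) g])
    fix X assume X: "X \<subseteq> P1" "(P1 - X) \<inter> g ` X = {}"
    let ?\<phi> = "\<lambda>z. if z \<in> P1 - X then \<phi>1 z else \<phi>2 z"
    have gX: "g ` X \<subseteq> P2" using g X(1) by (auto simp: bij_betw_def)
    have "inj_on ?\<phi> ((P1 - X) \<union> g ` X)"
    proof (rule inj_onI)
      fix u v
      assume uv: "u \<in> (P1 - X) \<union> g ` X" "v \<in> (P1 - X) \<union> g ` X" "?\<phi> u = ?\<phi> v"
      have cross: "\<phi>1 s \<noteq> \<phi>2 t" if st: "s \<in> P1 - X" "t \<in> g ` X" for s t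
      proof -
        obtain y where y: "y \<in> X" "t = g y" using st(2) by blast
        then have "\<phi>2 t = \<phi>1 y" "y \<in> P1" using X(1) \<phi>2g by auto
        then show ?thesis using inj_onD[OF \<phi>1(1), of s y] st(1) y(1) by auto
      qed
      show "u = v"
      proof (cases "u \<in> P1 - X"; cases "v \<in> P1 - X")
        assume "u \<in> P1 - X" "v \<in> P1 - X"
        then show ?thesis using uv(3) inj_onD[OF \<phi>1(1), of u v] by simp
      next
        assume "u \<in> P1 - X" "v \<notin> P1 - X"
        then show ?thesis using uv(2,3) cross[of u v] by auto
      next
        assume "u \<notin> P1 - X" "v \<in> P1 - X"
        then show ?thesis using uv(1,3) cross[of v u] by auto
      next
        assume *: "u \<notin> P1 - X" "v \<notin> P1 - X"
        then have "u \<in> P2" "v \<in> P2" using uv(1,2) gX by auto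
        moreover have "\<phi>2 u = \<phi>2 v" using uv(3) by (simp only: * if_False)
        ultimately show ?thesis using inj_onD[OF \<phi>2(1)] by blast
      qed
    qed
    moreover have "\<forall>z\<in>(P1 - X) \<union> g ` X. ?\<phi> z < length Ss \<and> z \<in> Ss ! ?\<phi> z"
      using \<phi>1(2) \<phi>2(2) gX by auto
    ultimately show "partial_transversal Ss ((P1 - X) \<union> g ` X)"
      unfolding partial_transversal_def by blast
  qed
qed


section \<open>Exchange-orderings\<close>

definition strong_ordering :: "'a matroid_data \<Rightarrow> 'a set \<Rightarrow> 'a set \<Rightarrow> ('a \<Rightarrow> 'a) \<Rightarrow> bool" where
  "strong_ordering M B1 B2 \<sigma> \<longleftrightarrow> bij_betw \<sigma> B1 B2 \<and> (\<forall>X\<subseteq>B1. (B1 - X) \<union> \<sigma> ` X \<in> bases M)"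

text \<open>Only one of the two exchanges has to be required, because the other one for \<open>X\<close> is the first one
  for \<open>B1 - X\<close>.\<close>

lemma strong_ordering_reverse:
  assumes "strong_ordering M B1 B2 \<sigma>" "X \<subseteq> B1"
  shows "(B2 - \<sigma> ` X) \<union> X \<in> bases M"
proof -
  have "(B1 - (B1 - X)) \<union> \<sigma> ` (B1 - X) \<in> bases M"
    using assms(1) by (simp add: strong_ordering_def)
  moreover have "\<sigma> ` (B1 - X) = B2 - \<sigma> ` X"
    using assms inj_on_image_set_diff[of \<sigma> B1 B1 X] by (simp add: strong_ordering_def bij_betw_def)
  moreover have "B1 - (B1 - X) = X" using assms(2) by blast
  ultimately show ?thesis by (simp add: Un_commute)
qed

lemma strong_ordering_exchange: "strong_ordering M B1 B2 \<sigma> \<Longrightarrow> exchange_ordering k M B1 B2 \<sigma>"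
  using strong_ordering_reverse[of M B1 B2 \<sigma>]
  by (simp add: exchange_ordering_def strong_ordering_def)

lemma strongly_base_orderableI:
  assumes "matroid M" "\<And>B1 B2. B1 \<in> bases M \<Longrightarrow> B2 \<in> bases M \<Longrightarrow> \<exists>\<sigma>. strong_ordering M B1 B2 \<sigma>"
  shows "M \<in> strongly_base_orderable"
  unfolding strongly_base_orderable_def
proof (intro CollectI conjI ballI)
  fix B1 B2 assume "B1 \<in> bases M" "B2 \<in> bases M"
  then obtain \<sigma> where \<sigma>: "strong_ordering M B1 B2 \<sigma>" using assms(2) by blast
  then show "\<exists>\<sigma>. bij_betw \<sigma> B1 B2 \<and>
    (\<forall>X\<subseteq>B1. B1 - X \<union> \<sigma> ` X \<in> bases M \<and> B2 - \<sigma> ` X \<union> X \<in> bases M)"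
    using strong_ordering_reverse[OF \<sigma>] by (auto simp: strong_ordering_def)
qed (rule assms(1))

lemma strongly_base_orderable_imp_base_orderable:
  "M \<in> strongly_base_orderable \<Longrightarrow> M \<in> base_orderable k"
  unfolding strongly_base_orderable_def base_orderable_def exchange_ordering_def
  by (simp, meson)

lemma exchange_ordering_inverse:
  assumes "exchange_ordering k M B1 B2 \<sigma>"
  shows "exchange_ordering k M B2 B1 (inv_into B1 \<sigma>)"
  unfolding exchange_ordering_def
proof (intro conjI allI impI)
  have bij: "bij_betw \<sigma> B1 B2" using assms by (simp add: exchange_ordering_def)
  show bij': "bij_betw (inv_into B1 \<sigma>) B2 B1" by (rule bij_betw_inv_into[OF bij])
  fix X assume X: "X \<subseteq> B2" "card X \<le> k"
  let ?Y = "inv_into B1 \<sigma> ` X"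
  have Y: "?Y \<subseteq> B1" using bij' X(1) by (auto simp: bij_betw_def)
  have img: "\<sigma> ` ?Y = X" using bij X(1) by (simp add: bij_betw_def image_inv_into_cancel)
  have "card ?Y \<le> k"
    using X bij' by (metis bij_betw_def card_image inj_on_subset)
  then have "B1 - ?Y \<union> \<sigma> ` ?Y \<in> bases M \<and> B2 - \<sigma> ` ?Y \<union> ?Y \<in> bases M"
    using assms Y by (simp add: exchange_ordering_def)
  then show "B2 - X \<union> ?Y \<in> bases M" "B1 - ?Y \<union> X \<in> bases M"
    by (simp_all only: img)
qed

context matroid
begin

lemma strong_ordering_fixes:
  assumes "strong_ordering M B1 B2 \<sigma>" "x \<in> B1" "x \<in> B2"
  shows "\<sigma> x = x"
proof (rule ccontr)
  assume ne: "\<sigma> x \<noteq> x"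
  have "\<sigma> ` B1 = B2" using assms(1) by (simp add: strong_ordering_def bij_betw_def)
  then have \<sigma>x: "\<sigma> x \<in> B2" using assms(2) by blast
  have "(B2 - \<sigma> ` {x}) \<union> {x} \<in> bases M"
    using strong_ordering_reverse[OF assms(1), of "{x}"] assms(2) by simp
  moreover have "(B2 - \<sigma> ` {x}) \<union> {x} = B2 - {\<sigma> x}" using ne assms(3) by auto
  moreover have "(B2 - \<sigma> ` {}) \<union> {} \<in> bases M" by (rule strong_ordering_reverse[OF assms(1)]) simp
  then have "B2 \<in> bases M" by simp
  ultimately show False
    using \<sigma>x card_bases finite_indep by (metis bases_iff card_Diff1_less less_irrefl)
qed

end

text \<open>A base pair of a proper minor lifts to a base pair of \<open>M\<close> that does not partition the ground
  set, and an ordering of the lifted pair fixes the elements added. So for proper minors to be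
  strongly base-orderable it suffices to order the pairs that do not partition the ground set.\<close>

lemma minor_strongly_base_orderable:
  assumes M: "matroid M" and minor: "proper_minor N M"
    and ordering: "\<And>B1 B2. B1 \<in> bases M \<Longrightarrow> B2 \<in> bases M \<Longrightarrow>
      B1 \<inter> B2 \<noteq> {} \<or> B1 \<union> B2 \<noteq> ground M \<Longrightarrow> \<exists>\<sigma>. strong_ordering M B1 B2 \<sigma>"
  shows "N \<in> strongly_base_orderable"
proof -
  obtain K where N: "matroid N" and sub: "ground N \<subset> ground M"
    and K: "K \<subseteq> ground M - ground N"
    and bases: "\<And>P. P \<in> bases N \<longleftrightarrow> P \<subseteq> ground N \<and> P \<union> K \<in> bases M"
    by (rule matroid.minor_lift[OF M minor]) (rule that)
  show ?thesis
  proof (rule strongly_base_orderableI[OF N])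
    fix P1 P2 assume "P1 \<in> bases N" "P2 \<in> bases N"
    then have P: "P1 \<subseteq> ground N" "P1 \<union> K \<in> bases M" "P2 \<subseteq> ground N" "P2 \<union> K \<in> bases M"
      using bases by auto
    have "(P1 \<union> K) \<inter> (P2 \<union> K) \<noteq> {} \<or> (P1 \<union> K) \<union> (P2 \<union> K) \<noteq> ground M"
      using P(1,3) sub by blast
    then obtain \<sigma> where \<sigma>: "strong_ordering M (P1 \<union> K) (P2 \<union> K) \<sigma>"
      using ordering P(2,4) by blast
    have inj: "inj_on \<sigma> (P1 \<union> K)" and img: "\<sigma> ` (P1 \<union> K) = P2 \<union> K"
      using \<sigma> by (auto simp: strong_ordering_def bij_betw_def)
    have fixK: "\<sigma> z = z" if "z \<in> K" for z using matroid.strong_ordering_fixes[OF M \<sigma>] that by blast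
    then have imgK: "\<sigma> ` K = K" by simp
    have PK: "P1 \<inter> K = {}" "P2 \<inter> K = {}" using P K by auto
    have "\<sigma> ` P1 \<inter> \<sigma> ` K = {}"
      using inj_on_image_Int[OF inj, of P1 K] PK(1) by simp
    moreover have "\<sigma> ` P1 \<union> K = P2 \<union> K" using img imgK by (simp add: image_Un)
    ultimately have imgP: "\<sigma> ` P1 = P2" using imgK PK(2) by auto
    have "strong_ordering N P1 P2 \<sigma>"
      unfolding strong_ordering_def
    proof (intro conjI allI impI)
      show "bij_betw \<sigma> P1 P2" using inj imgP by (simp add: bij_betw_def inj_on_Un)
      fix X assume X: "X \<subseteq> P1"
      have "(P1 \<union> K - X) \<union> \<sigma> ` X \<in> bases M" using \<sigma> X by (simp add: strong_ordering_def le_supI1)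
      moreover have "(P1 \<union> K - X) \<union> \<sigma> ` X = (P1 - X \<union> \<sigma> ` X) \<union> K" using X PK(1) by blast
      moreover have "P1 - X \<union> \<sigma> ` X \<subseteq> ground N" using P X imgP by blast
      ultimately show "P1 - X \<union> \<sigma> ` X \<in> bases N" using bases by simp
    qed
    then show "\<exists>\<sigma>. strong_ordering N P1 P2 \<sigma>" by blast
  qed
qed

section \<open>The matroid \<open>M_\<beta>\<close>\<close>

locale M_beta =
  fixes k :: nat and A B C D E F :: "'a set" and M :: "'a matroid_data"
  assumes tuple: "beta_tuple k A B C D E F"
    and is_M_beta: "is_M_beta k A B C D E F M"
begin

sublocale matroid M
  using is_M_beta by (simp add: is_M_beta_def)

lemma ground: "ground M = A \<union> B \<union> C \<union> D \<union> E \<union> F"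
  using is_M_beta by (simp add: is_M_beta_def)

lemma finite_classes [simp]:
  "finite A" "finite B" "finite C" "finite D" "finite E" "finite F"
  using tuple by (auto simp: beta_tuple_def)

lemma disjoint_classes [simp]:
  "A \<inter> B = {}" "A \<inter> C = {}" "A \<inter> D = {}" "A \<inter> E = {}" "A \<inter> F = {}"
  "B \<inter> C = {}" "B \<inter> D = {}" "B \<inter> E = {}" "B \<inter> F = {}"
  "C \<inter> D = {}" "C \<inter> E = {}" "C \<inter> F = {}"
  "D \<inter> E = {}" "D \<inter> F = {}" "E \<inter> F = {}"
proof -
  have ne: "distinct [A, B, C, D, E, F]" and pw: "pairwise disjnt {A, B, C, D, E, F}"
    using tuple by (simp_all add: beta_tuple_def)
  have dj: "P \<inter> Q = {}" if "P \<in> {A, B, C, D, E, F}" "Q \<in> {A, B, C, D, E, F}" "P \<noteq> Q" for P Q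
    using pairwiseD[OF pw] that by (simp add: disjnt_def)
  show "A \<inter> B = {}" "A \<inter> C = {}" "A \<inter> D = {}" "A \<inter> E = {}" "A \<inter> F = {}"
    "B \<inter> C = {}" "B \<inter> D = {}" "B \<inter> E = {}" "B \<inter> F = {}"
    "C \<inter> D = {}" "C \<inter> E = {}" "C \<inter> F = {}"
    "D \<inter> E = {}" "D \<inter> F = {}" "E \<inter> F = {}"
    by (rule dj, blast, blast, use ne in simp)+
qed

lemma disjoint_classes_sym [simp]:
  "B \<inter> A = {}" "C \<inter> A = {}" "D \<inter> A = {}" "E \<inter> A = {}" "F \<inter> A = {}"
  "C \<inter> B = {}" "D \<inter> B = {}" "E \<inter> B = {}" "F \<inter> B = {}"
  "D \<inter> C = {}" "E \<inter> C = {}" "F \<inter> C = {}"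
  "E \<inter> D = {}" "F \<inter> D = {}" "F \<inter> E = {}"
  by (simp_all add: Int_commute)

lemma class_sizes:
  "card A + card B = k" "card D + card E = k" "card C = k" "card F = k"
  "0 < card A" "0 < card B" "0 < card D" "0 < card E"
  using tuple by (auto simp: beta_tuple_def card_gt_0_iff card_Un_disjoint[symmetric])

text \<open>The rotation \<open>A \<mapsto> E \<mapsto> B \<mapsto> D \<mapsto> A\<close>, \<open>C \<mapsto> F \<mapsto> C\<close> of the tuple describes the same matroid, so the classes
  \<open>A\<close>, \<open>B\<close>, \<open>D\<close>, \<open>E\<close> are alike, and so are \<open>C\<close> and \<open>F\<close>.\<close>

lemma rotate: "M_beta k E D F A B C M"
proof
  have perm: "{E, D, F, A, B, C} = {A, B, C, D, E, F}" by blast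
  have "distinct [A, B, C, D, E, F]" using tuple by (simp add: beta_tuple_def)
  then have "distinct [E, D, F, A, B, C]" by simp (metis)
  then show "beta_tuple k E D F A B C"
    using tuple unfolding beta_tuple_def perm Un_commute[of E D] by simp
  have "ground M = E \<union> D \<union> F \<union> A \<union> B \<union> C" "E \<union> D \<union> A \<union> B = A \<union> B \<union> D \<union> E"
    using ground by auto
  moreover have "{ground M, A \<union> B \<union> D \<union> E, F \<union> D \<union> B, F \<union> E \<union> A, C \<union> B \<union> E, C \<union> A \<union> D, {}} =
    {ground M, A \<union> B \<union> D \<union> E, C \<union> B \<union> E, C \<union> A \<union> D, F \<union> E \<union> A, F \<union> D \<union> B, {}}"
    by (simp add: insert_commute)
  ultimately show "is_M_beta k E D F A B C M"
    using is_M_beta unfolding is_M_beta_def by metis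
qed

lemma card_Int_Un3:
  assumes "P \<inter> Q = {}" "P \<inter> R = {}" "Q \<inter> R = {}" "finite P" "finite Q" "finite R"
  shows "card (W \<inter> (P \<union> Q \<union> R)) = card (W \<inter> P) + card (W \<inter> Q) + card (W \<inter> R)"
proof -
  have "W \<inter> (P \<union> Q \<union> R) = W \<inter> P \<union> W \<inter> Q \<union> W \<inter> R" by blast
  also have "card \<dots> = card (W \<inter> P \<union> W \<inter> Q) + card (W \<inter> R)"
    using assms by (intro card_Un_disjoint) auto
  also have "card (W \<inter> P \<union> W \<inter> Q) = card (W \<inter> P) + card (W \<inter> Q)"
    using assms by (intro card_Un_disjoint) auto
  finally show ?thesis .
qed

lemma card_Int_ground:
  "card (W \<inter> ground M) = card (W \<inter> A) + card (W \<inter> B) + card (W \<inter> C) + card (W \<inter> D)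
     + card (W \<inter> E) + card (W \<inter> F)"
proof -
  have "W \<inter> ground M = W \<inter> (A \<union> B \<union> C) \<union> W \<inter> (D \<union> E \<union> F)" using ground by blast
  also have "card \<dots> = card (W \<inter> (A \<union> B \<union> C)) + card (W \<inter> (D \<union> E \<union> F))"
  proof (rule card_Un_disjoint)
    have "(A \<union> B \<union> C) \<inter> (D \<union> E \<union> F) = {}" by (simp add: Int_Un_distrib Int_Un_distrib2)
    then show "W \<inter> (A \<union> B \<union> C) \<inter> (W \<inter> (D \<union> E \<union> F)) = {}" by blast
  qed auto
  finally show ?thesis by (simp add: card_Int_Un3)
qed

lemma card_eq_sum:
  "W \<subseteq> ground M \<Longrightarrow> card W = card (W \<inter> A) + card (W \<inter> B) + card (W \<inter> C) + card (W \<inter> D)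
     + card (W \<inter> E) + card (W \<inter> F)"
  using card_Int_ground[of W] by (simp add: Int_absorb2)

lemma card_Int_hyperplane:
  "card (W \<inter> (A \<union> B \<union> D \<union> E)) = card (W \<inter> A) + card (W \<inter> B) + card (W \<inter> D) + card (W \<inter> E)"
proof -
  have "W \<inter> (A \<union> B \<union> D \<union> E) = W \<inter> (A \<union> B \<union> D) \<union> W \<inter> E" by blast
  also have "card \<dots> = card (W \<inter> (A \<union> B \<union> D)) + card (W \<inter> E)"
  proof (rule card_Un_disjoint)
    have "(A \<union> B \<union> D) \<inter> E = {}" by (simp add: Int_Un_distrib Int_Un_distrib2)
    then show "W \<inter> (A \<union> B \<union> D) \<inter> (W \<inter> E) = {}" by blast
  qed auto
  finally show ?thesis by (simp add: card_Int_Un3)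
qed

lemma cyclic_flats: "cyclic_flats M = {ground M, A \<union> B \<union> D \<union> E, C \<union> B \<union> E, C \<union> A \<union> D,
    F \<union> E \<union> A, F \<union> D \<union> B, {}}"
  and ranks: "rk M (ground M) = 2 * k" "rk M (A \<union> B \<union> D \<union> E) = 2 * k - 1"
    "rk M (C \<union> B \<union> E) = k + card B" "rk M (C \<union> A \<union> D) = k + card A"
    "rk M (F \<union> E \<union> A) = k + card E" "rk M (F \<union> D \<union> B) = k + card D"
  by (insert is_M_beta, unfold is_M_beta_def) (elim conjE, assumption)+

lemma indep_iff:
  "W \<in> indeps M \<longleftrightarrow> W \<subseteq> ground M \<and> card W \<le> 2 * k \<and>
     card (W \<inter> A) + card (W \<inter> B) + card (W \<inter> D) + card (W \<inter> E) \<le> 2 * k - 1 \<and>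
     card (W \<inter> C) + card (W \<inter> B) + card (W \<inter> E) \<le> k + card B \<and>
     card (W \<inter> C) + card (W \<inter> A) + card (W \<inter> D) \<le> k + card A \<and>
     card (W \<inter> F) + card (W \<inter> E) + card (W \<inter> A) \<le> k + card E \<and>
     card (W \<inter> F) + card (W \<inter> D) + card (W \<inter> B) \<le> k + card D"
proof -
  have "W \<in> indeps M \<longleftrightarrow> W \<subseteq> ground M \<and> card (W \<inter> ground M) \<le> 2 * k \<and>
     card (W \<inter> (A \<union> B \<union> D \<union> E)) \<le> 2 * k - 1 \<and>
     card (W \<inter> (C \<union> B \<union> E)) \<le> k + card B \<and> card (W \<inter> (C \<union> A \<union> D)) \<le> k + card A \<and>
     card (W \<inter> (F \<union> E \<union> A)) \<le> k + card E \<and> card (W \<inter> (F \<union> D \<union> B)) \<le> k + card D"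
    unfolding indep_iff_cyclic_flats[of W] cyclic_flats by (simp add: ranks)
  moreover have "card (W \<inter> ground M) = card W" if "W \<subseteq> ground M"
    using that by (simp add: Int_absorb2)
  moreover have "card (W \<inter> (C \<union> B \<union> E)) = card (W \<inter> C) + card (W \<inter> B) + card (W \<inter> E)"
    "card (W \<inter> (C \<union> A \<union> D)) = card (W \<inter> C) + card (W \<inter> A) + card (W \<inter> D)"
    "card (W \<inter> (F \<union> E \<union> A)) = card (W \<inter> F) + card (W \<inter> E) + card (W \<inter> A)"
    "card (W \<inter> (F \<union> D \<union> B)) = card (W \<inter> F) + card (W \<inter> D) + card (W \<inter> B)"
    by (simp_all only: card_Int_Un3 disjoint_classes disjoint_classes_sym finite_classes)
  ultimately show ?thesis unfolding card_Int_hyperplane by (cases "W \<subseteq> ground M") simp_all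
qed

lemma basis_iff: "W \<in> bases M \<longleftrightarrow> W \<in> indeps M \<and> card W = 2 * k"
  by (simp add: bases_iff ranks)

lemma card_Int_le:
  "card (W \<inter> A) \<le> card A" "card (W \<inter> B) \<le> card B" "card (W \<inter> C) \<le> k"
  "card (W \<inter> D) \<le> card D" "card (W \<inter> E) \<le> card E" "card (W \<inter> F) \<le> k"
  using class_sizes(3,4) by (metis finite_classes card_mono inf_le2)+

end

section \<open>Contractions are transversal\<close>

definition presents :: "'a set list \<Rightarrow> 'a matroid_data \<Rightarrow> bool" where
  "presents Ss N \<longleftrightarrow> (\<forall>S\<in>set Ss. S \<subseteq> ground N) \<and>
     (\<forall>X. X \<in> indeps N \<longleftrightarrow> X \<subseteq> ground N \<and> partial_transversal Ss X)"

lemma meets_iff: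
  assumes "finite P" "finite Q" "finite R"
  shows "(P \<union> Q \<union> R) \<inter> J \<noteq> {} \<longleftrightarrow> card (J \<inter> P) + card (J \<inter> Q) + card (J \<inter> R) \<noteq> 0"
proof -
  have "card (J \<inter> P) + card (J \<inter> Q) + card (J \<inter> R) = 0 \<longleftrightarrow>
      J \<inter> P = {} \<and> J \<inter> Q = {} \<and> J \<inter> R = {}"
    using assms by simp
  moreover have "(P \<union> Q \<union> R) \<inter> J = {} \<longleftrightarrow> J \<inter> P = {} \<and> J \<inter> Q = {} \<and> J \<inter> R = {}" by blast
  ultimately show ?thesis by metis
qed

lemma length_filter_replicate: "length (filter P (replicate n S)) = (if P S then n else 0)"
  by (simp add: filter_replicate)

text \<open>The next two lemmas are Hall's condition for the presentations of \<open>M/x\<close> below. The numbers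
  \<open>jA\<close>, ..., \<open>jF\<close> count the elements of a set in the six classes, the inequalities say that the set
  together with \<open>x\<close> is independent, and \<open>m1\<close>, ..., \<open>m5\<close> bound the number of members of each kind that the
  set meets. If the set meets members of every kind, its size suffices; if it misses a kind, it lies
  in the complementary cyclic flat, whose rank gives the bound, unless it misses further kinds and
  is confined to few classes.\<close>

lemma Hall_count_C:
  fixes a b d e k :: nat
  assumes sizes: "a + b = k" "d + e = k" "0 < d" "0 < e"
    and cls: "jB \<le> b" "Suc jC \<le> k" "jD \<le> d" "jE \<le> e" "jF \<le> k" "jA \<le> a"
    and total: "Suc (jA + jB + jC + jD + jE + jF) \<le> 2 * k"
    and CBE: "Suc jC + jB + jE \<le> k + b" and CAD: "Suc jC + jA + jD \<le> k + a"
    and FEA: "jF + jE + jA \<le> k + e" and FDB: "jF + jD + jB \<le> k + d"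
    and met: "jA + jD + jF = 0 \<or> a \<le> m1" "jB + jE + jF = 0 \<or> b \<le> m2"
      "jB + jC + jD = 0 \<or> d \<le> Suc m3" "jA + jC + jE = 0 \<or> e \<le> Suc m4"
      "jA + jB + jC + jD + jE + jF = 0 \<or> 1 \<le> m5"
  shows "jA + jB + jC + jD + jE + jF \<le> m1 + m2 + m3 + m4 + m5"
proof (cases "jA + jB + jC + jD + jE + jF = 0")
  case False
  then have m5: "1 \<le> m5" using met(5) by blast
  consider (ADF) "jA = 0" "jD = 0" "jF = 0" | (BEF) "jB = 0" "jE = 0" "jF = 0" "a \<le> m1"
    | (BCD) "jB = 0" "jC = 0" "jD = 0" "a \<le> m1" "b \<le> m2"
    | (ACE) "jA = 0" "jC = 0" "jE = 0" "a \<le> m1" "b \<le> m2" "d \<le> Suc m3"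
    | (all) "a \<le> m1" "b \<le> m2" "d \<le> Suc m3" "e \<le> Suc m4"
    using met(1-4) by fastforce
  then show ?thesis
  proof cases
    case ADF
    then have J: "jA + jB + jC + jD + jE + jF = jB + jC + jE" by simp
    show ?thesis unfolding J
    proof (cases "jC = 0")
      case True
      then have "jB = 0 \<or> b \<le> m2 \<and> d \<le> Suc m3" "jE = 0 \<or> b \<le> m2 \<and> e \<le> Suc m4"
        using met(2-4) ADF by auto
      then show "jB + jC + jE \<le> m1 + m2 + m3 + m4 + m5"
        using True cls(1,4) m5 sizes by (elim disjE conjE) linarith+
    next
      case False
      then have m34: "d \<le> Suc m3" "e \<le> Suc m4" using met(3,4) by auto
      have "jB + jE = 0 \<or> b \<le> m2" using met(2) ADF by auto
      then show "jB + jC + jE \<le> m1 + m2 + m3 + m4 + m5"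
        using m34 m5 sizes(2) cls(2) CBE by (elim disjE) linarith+
    qed
  next
    case BEF
    then have J: "jA + jB + jC + jD + jE + jF = jA + jC + jD" by simp
    have "jC + jD = 0 \<or> d \<le> Suc m3" "jA + jC = 0 \<or> e \<le> Suc m4" using met(3,4) BEF by auto
    then show ?thesis unfolding J
      using BEF(4) m5 sizes(2) cls(3,6) CAD by (elim disjE) linarith+
  next
    case BCD
    then have J: "jA + jB + jC + jD + jE + jF = jA + jE + jF" by simp
    have "jA + jE = 0 \<or> e \<le> Suc m4" using met(4) BCD by auto
    then show ?thesis unfolding J
      using BCD(4,5) m5 sizes(1) cls(5) FEA by (elim disjE) linarith+
  next
    case ACE
    then have J: "jA + jB + jC + jD + jE + jF = jB + jD + jF" by simp
    show ?thesis unfolding J using ACE(4-6) m5 sizes(1) FDB by linarith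
  next
    case all
    then show ?thesis using m5 sizes(1,2) total by linarith
  qed
qed simp

lemma Hall_count_A:
  fixes a b d e k :: nat
  assumes sizes: "a + b = k" "d + e = k" "0 < a" "0 < b" "0 < d" "0 < e"
    and cls: "Suc jA \<le> a" "jB \<le> b" "jC \<le> k" "jD \<le> d" "jE \<le> e" "jF \<le> k"
    and total: "Suc (jA + jB + jC + jD + jE + jF) \<le> 2 * k"
    and ABDE: "Suc (Suc (jA + jB + jD + jE)) \<le> 2 * k"
    and CBE: "jC + jB + jE \<le> k + b" and CAD: "jC + Suc jA + jD \<le> k + a"
    and FEA: "jF + jE + Suc jA \<le> k + e" and FDB: "jF + jD + jB \<le> k + d"
    and met: "jA + jD + jF = 0 \<or> a \<le> Suc m1" "jB + jE + jF = 0 \<or> b \<le> m2"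
      "jB + jC + jD = 0 \<or> d \<le> m3" "jA + jC + jE = 0 \<or> e \<le> Suc m4"
      "jC + jF = 0 \<or> 1 \<le> m5"
  shows "jA + jB + jC + jD + jE + jF \<le> m1 + m2 + m3 + m4 + m5"
proof -
  consider (ADF) "jA = 0" "jD = 0" "jF = 0" | (BEF) "jB = 0" "jE = 0" "jF = 0" "a \<le> Suc m1"
    | (BCD) "jB = 0" "jC = 0" "jD = 0" "a \<le> Suc m1" "b \<le> m2"
    | (ACE) "jA = 0" "jC = 0" "jE = 0" "a \<le> Suc m1" "b \<le> m2" "d \<le> m3"
    | (all) "a \<le> Suc m1" "b \<le> m2" "d \<le> m3" "e \<le> Suc m4"
    using met(1-4) by fastforce
  then show ?thesis
  proof cases
    case ADF
    then have J: "jA + jB + jC + jD + jE + jF = jB + jC + jE" by simp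
    show ?thesis unfolding J
    proof (cases "jC = 0")
      case True
      then have "jB = 0 \<or> b \<le> m2 \<and> d \<le> m3" "jE = 0 \<or> b \<le> m2 \<and> e \<le> Suc m4"
        using met(2-4) ADF by auto
      then show "jB + jC + jE \<le> m1 + m2 + m3 + m4 + m5"
        using True cls(2,5) sizes(4,5) by (elim disjE conjE) linarith+
    next
      case False
      then have m345: "d \<le> m3" "e \<le> Suc m4" "1 \<le> m5" using met(3-5) by auto
      have "jB + jE = 0 \<or> b \<le> m2" using met(2) ADF by auto
      then show "jB + jC + jE \<le> m1 + m2 + m3 + m4 + m5"
        using m345 sizes(2) cls(3) CBE by (elim disjE) linarith+
    qed
  next
    case BEF
    then have J: "jA + jB + jC + jD + jE + jF = jA + jC + jD" by simp
    show ?thesis unfolding J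
    proof (cases "jC = 0")
      case True
      then have "jD = 0 \<or> d \<le> m3" using met(3) by auto
      then show "jA + jC + jD \<le> m1 + m2 + m3 + m4 + m5"
        using True BEF(4) cls(1,4) by (elim disjE) linarith+
    next
      case False
      then have "d \<le> m3" "e \<le> Suc m4" "1 \<le> m5" using met(3-5) by auto
      then show "jA + jC + jD \<le> m1 + m2 + m3 + m4 + m5"
        using BEF(4) sizes(2) CAD by linarith
    qed
  next
    case BCD
    then have J: "jA + jB + jC + jD + jE + jF = jA + jE + jF" by simp
    have "jF = 0 \<or> 1 \<le> m5" "jA + jE = 0 \<or> e \<le> Suc m4" using met(4,5) BCD by auto
    then show ?thesis unfolding J
      using BCD(4,5) sizes(1,4) cls(1,5,6) FEA by (elim disjE) linarith+
  next
    case ACE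
    then have J: "jA + jB + jC + jD + jE + jF = jB + jD + jF" by simp
    have "jF = 0 \<or> 1 \<le> m5" using met(5) ACE by auto
    then show ?thesis unfolding J
      using ACE(4-6) sizes(1) cls(2,4) FDB by (elim disjE) linarith+
  next
    case all
    have "jC + jF = 0 \<or> 1 \<le> m5" using met(5) by auto
    then show ?thesis using all sizes(1,2) ABDE total by (elim disjE) linarith+
  qed
qed

context M_beta
begin

lemma card_insert_Int:
  assumes "x \<in> P" "x \<notin> I" "finite P"
  shows "card (insert x I \<inter> P) = Suc (card (I \<inter> P))"
  using assms by (simp add: Int_insert_left)

lemma singleton_indep: "x \<in> ground M \<Longrightarrow> {x} \<in> indeps M"
proof -
  assume x: "x \<in> ground M"
  then have "card ({x} \<inter> A) + card ({x} \<inter> B) + card ({x} \<inter> C) + card ({x} \<inter> D)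
      + card ({x} \<inter> E) + card ({x} \<inter> F) = 1"
    using card_eq_sum[of "{x}"] by simp
  then show ?thesis using x class_sizes unfolding indep_iff by simp
qed

lemma contract_singleton:
  assumes "x \<in> ground M"
  shows "ground (contract M {x}) = ground M - {x}"
    and "I \<in> indeps (contract M {x}) \<longleftrightarrow> I \<subseteq> ground M - {x} \<and> insert x I \<in> indeps M"
proof -
  show "ground (contract M {x}) = ground M - {x}" by (simp add: contract_def)
  have "indeps (contract M {x}) = {I. I \<subseteq> ground M - {x} \<and> I \<union> {x} \<in> indeps M}"
    using assms singleton_indep[OF assms] by (intro contract_indeps) (auto simp: rk_indep)
  then show "I \<in> indeps (contract M {x}) \<longleftrightarrow> I \<subseteq> ground M - {x} \<and> insert x I \<in> indeps M"
    by simp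
qed

text \<open>The four flats that contain \<open>C\<close> or \<open>F\<close> contribute their complements. For instance \<open>C \<union> B \<union> E\<close> has rank
  \<open>k + card B - 1\<close> in \<open>M/x\<close> for \<open>x \<in> C\<close>, so \<open>2 * k - 1 - (k + card B - 1) = card A\<close> members have to
  miss it. These multiplicities add up to \<open>2 * k - 2\<close>, and the whole ground set supplies the
  remaining member. The hyperplane \<open>A \<union> B \<union> D \<union> E\<close> imposes no condition because it has full rank in
  \<open>M/x\<close>.\<close>

lemma contract_C_presentation:
  assumes x: "x \<in> C"
  defines "Ss \<equiv> replicate (card A) (A \<union> D \<union> F) @ replicate (card B) (B \<union> E \<union> F)
    @ replicate (card D - 1) (B \<union> (C - {x}) \<union> D) @ replicate (card E - 1) (A \<union> (C - {x}) \<union> E)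
    @ replicate 1 (ground M - {x})"
  shows "length Ss = 2 * k - 1 \<and> presents Ss (contract M {x})"
proof
  show len: "length Ss = 2 * k - 1" using class_sizes by (simp add: Ss_def)
  have xg: "x \<in> ground M" using x ground by blast
  have "x \<notin> P" if "P \<inter> C = {}" for P using that x by blast
  then have x': "x \<notin> A" "x \<notin> B" "x \<notin> D" "x \<notin> E" "x \<notin> F" by simp_all
  let ?m = "\<lambda>J. length (filter (\<lambda>S. S \<inter> J \<noteq> {}) Ss)"
  have m: "?m J = (if card (J \<inter> A) + card (J \<inter> D) + card (J \<inter> F) \<noteq> 0 then card A else 0)
      + (if card (J \<inter> B) + card (J \<inter> E) + card (J \<inter> F) \<noteq> 0 then card B else 0)
      + (if card (J \<inter> B) + card (J \<inter> C) + card (J \<inter> D) \<noteq> 0 then card D - 1 else 0)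
      + (if card (J \<inter> A) + card (J \<inter> C) + card (J \<inter> E) \<noteq> 0 then card E - 1 else 0)
      + (if card (J \<inter> A) + card (J \<inter> B) + card (J \<inter> C) + card (J \<inter> D) + card (J \<inter> E)
          + card (J \<inter> F) \<noteq> 0 then 1 else 0)"
    if J: "J \<subseteq> ground M - {x}" for J
  proof -
    have fJ: "finite J" using J finite_ground by (meson finite_Diff finite_subset)
    have J': "(B \<union> (C - {x}) \<union> D) \<inter> J = (B \<union> C \<union> D) \<inter> J"
      "(A \<union> (C - {x}) \<union> E) \<inter> J = (A \<union> C \<union> E) \<inter> J" "(ground M - {x}) \<inter> J = J"
      using J by blast+
    have "J \<noteq> {} \<longleftrightarrow> card J \<noteq> 0" using fJ by simp
    moreover have "card J = card (J \<inter> A) + card (J \<inter> B) + card (J \<inter> C) + card (J \<inter> D)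
        + card (J \<inter> E) + card (J \<inter> F)"
      using J by (intro card_eq_sum) blast
    ultimately have "J \<noteq> {} \<longleftrightarrow> card (J \<inter> A) + card (J \<inter> B) + card (J \<inter> C) + card (J \<inter> D)
        + card (J \<inter> E) + card (J \<inter> F) \<noteq> 0" by metis
    then show ?thesis
      unfolding Ss_def
      by (simp only: filter_append length_append length_filter_replicate J' meets_iff
        finite_classes add.assoc)
  qed
  have ins: "card (insert x I \<inter> C) = Suc (card (I \<inter> C))" "insert x I \<inter> A = I \<inter> A"
    "insert x I \<inter> B = I \<inter> B" "insert x I \<inter> D = I \<inter> D" "insert x I \<inter> E = I \<inter> E"
    "insert x I \<inter> F = I \<inter> F" if "x \<notin> I" for I
    using that x x' by (auto simp: card_insert_Int)
  have indep: "insert x I \<in> indeps M \<longleftrightarrow>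
      Suc (card I) \<le> 2 * k \<and>
      card (I \<inter> A) + card (I \<inter> B) + card (I \<inter> D) + card (I \<inter> E) \<le> 2 * k - 1 \<and>
      Suc (card (I \<inter> C)) + card (I \<inter> B) + card (I \<inter> E) \<le> k + card B \<and>
      Suc (card (I \<inter> C)) + card (I \<inter> A) + card (I \<inter> D) \<le> k + card A \<and>
      card (I \<inter> F) + card (I \<inter> E) + card (I \<inter> A) \<le> k + card E \<and>
      card (I \<inter> F) + card (I \<inter> D) + card (I \<inter> B) \<le> k + card D"
    if I: "I \<subseteq> ground M - {x}" for I
  proof -
    have "x \<notin> I" "insert x I \<subseteq> ground M" using I xg by auto
    moreover have "card (insert x I) = Suc (card I)"
      using \<open>x \<notin> I\<close> I finite_ground by (metis card_insert_disjoint finite_Diff finite_subset)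
    ultimately show ?thesis unfolding indep_iff by (simp add: ins)
  qed
  have "insert x I \<in> indeps M \<longleftrightarrow> partial_transversal Ss I" if I: "I \<subseteq> ground M - {x}" for I
  proof
    assume ind: "insert x I \<in> indeps M"
    have "card J \<le> ?m J" if J: "J \<subseteq> I" for J
    proof -
      have Jg: "J \<subseteq> ground M - {x}" using J I by blast
      have cJ: "card J = card (J \<inter> A) + card (J \<inter> B) + card (J \<inter> C) + card (J \<inter> D)
          + card (J \<inter> E) + card (J \<inter> F)"
        using Jg by (intro card_eq_sum) blast
      have "insert x J \<in> indeps M" using J by (intro indep_subset[OF ind]) blast
      note indepJ = this[unfolded indep[OF Jg] cJ]
      have "card (insert x J \<inter> C) \<le> k" by (rule card_Int_le)
      moreover have "x \<notin> J" using Jg by blast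
      ultimately have "Suc (card (J \<inter> C)) \<le> k" using ins(1) by simp
      then show ?thesis
        unfolding m[OF Jg] unfolding cJ
        by (intro Hall_count_C[OF class_sizes(1,2,7,8)]) (use indepJ class_sizes(7,8) in \<open>simp_all add: card_Int_le\<close>)
    qed
    then show "partial_transversal Ss I"
      using I finite_ground by (subst partial_transversal_iff_Hall) (auto intro: finite_subset)
  next
    assume "partial_transversal Ss I"
    moreover have "finite I" using I finite_ground by (meson finite_Diff finite_subset)
    ultimately have hall: "card J \<le> ?m J" if "J \<subseteq> I" for J
      using that partial_transversal_iff_Hall by blast
    have hall_Int: "card (I \<inter> Z) \<le> ?m (I \<inter> Z)" "I \<inter> Z \<subseteq> ground M" "I \<inter> Z \<subseteq> ground M - {x}" for Z
      using hall[of "I \<inter> Z"] I by blast+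
    have 1: "Suc (card I) \<le> 2 * k"
      using hall[OF order_refl] length_filter_le[of "\<lambda>S. S \<inter> I \<noteq> {}" Ss] len class_sizes(1,5) by linarith
    have 2: "Suc (card (I \<inter> C)) + card (I \<inter> B) + card (I \<inter> E) \<le> k + card B"
      using hall_Int(1)[of "C \<union> B \<union> E"] class_sizes
      unfolding m[OF hall_Int(3)] card_eq_sum[OF hall_Int(2)]
      by (simp add: Int_assoc Int_Un_distrib2 split: if_splits)
    have 3: "Suc (card (I \<inter> C)) + card (I \<inter> A) + card (I \<inter> D) \<le> k + card A"
      using hall_Int(1)[of "C \<union> A \<union> D"] class_sizes
      unfolding m[OF hall_Int(3)] card_eq_sum[OF hall_Int(2)]
      by (simp add: Int_assoc Int_Un_distrib2 split: if_splits)
    have 4: "card (I \<inter> F) + card (I \<inter> E) + card (I \<inter> A) \<le> k + card E"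
      using hall_Int(1)[of "F \<union> E \<union> A"] class_sizes
      unfolding m[OF hall_Int(3)] card_eq_sum[OF hall_Int(2)]
      by (simp add: Int_assoc Int_Un_distrib2 split: if_splits)
    have 5: "card (I \<inter> F) + card (I \<inter> D) + card (I \<inter> B) \<le> k + card D"
      using hall_Int(1)[of "F \<union> D \<union> B"] class_sizes
      unfolding m[OF hall_Int(3)] card_eq_sum[OF hall_Int(2)]
      by (simp add: Int_assoc Int_Un_distrib2 split: if_splits)
    have "card I = card (I \<inter> A) + card (I \<inter> B) + card (I \<inter> C) + card (I \<inter> D) + card (I \<inter> E)
        + card (I \<inter> F)"
      using I by (intro card_eq_sum) blast
    then show "insert x I \<in> indeps M" unfolding indep[OF I] using 1 2 3 4 5 by linarith
  qed
  moreover have "S \<subseteq> ground M - {x}" if "S \<in> set Ss" for S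
    using that x' ground by (auto simp: Ss_def)
  ultimately show "presents Ss (contract M {x})"
    unfolding presents_def contract_singleton[OF xg] by blast
qed

text \<open>For \<open>x \<in> A\<close> the hyperplane remains a hyperplane of \<open>M/x\<close>, so one member is its complement
  \<open>C \<union> F\<close>; the multiplicities of the other complements are computed as before.\<close>

lemma contract_A_presentation:
  assumes x: "x \<in> A"
  defines "Ss \<equiv> replicate (card A - 1) ((A - {x}) \<union> D \<union> F) @ replicate (card B) (B \<union> E \<union> F)
    @ replicate (card D) (B \<union> C \<union> D) @ replicate (card E - 1) ((A - {x}) \<union> C \<union> E)
    @ replicate 1 (C \<union> F)"
  shows "length Ss = 2 * k - 1 \<and> presents Ss (contract M {x})"
proof
  show len: "length Ss = 2 * k - 1" using class_sizes by (simp add: Ss_def)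
  have xg: "x \<in> ground M" using x ground by blast
  have "x \<notin> P" if "P \<inter> A = {}" for P using that x by blast
  then have x': "x \<notin> B" "x \<notin> C" "x \<notin> D" "x \<notin> E" "x \<notin> F" by simp_all
  let ?m = "\<lambda>J. length (filter (\<lambda>S. S \<inter> J \<noteq> {}) Ss)"
  have m: "?m J = (if card (J \<inter> A) + card (J \<inter> D) + card (J \<inter> F) \<noteq> 0 then card A - 1 else 0)
      + (if card (J \<inter> B) + card (J \<inter> E) + card (J \<inter> F) \<noteq> 0 then card B else 0)
      + (if card (J \<inter> B) + card (J \<inter> C) + card (J \<inter> D) \<noteq> 0 then card D else 0)
      + (if card (J \<inter> A) + card (J \<inter> C) + card (J \<inter> E) \<noteq> 0 then card E - 1 else 0)
      + (if card (J \<inter> C) + card (J \<inter> F) \<noteq> 0 then 1 else 0)"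
    if J: "J \<subseteq> ground M - {x}" for J
  proof -
    have J': "((A - {x}) \<union> D \<union> F) \<inter> J = (A \<union> D \<union> F) \<inter> J"
      "((A - {x}) \<union> C \<union> E) \<inter> J = (A \<union> C \<union> E) \<inter> J"
      using J by blast+
    have "(C \<union> F \<union> {}) \<inter> J \<noteq> {} \<longleftrightarrow> card (J \<inter> C) + card (J \<inter> F) + card (J \<inter> {}) \<noteq> 0"
      by (intro meets_iff) simp_all
    then have CF: "(C \<union> F) \<inter> J \<noteq> {} \<longleftrightarrow> card (J \<inter> C) + card (J \<inter> F) \<noteq> 0" by simp
    show ?thesis
      unfolding Ss_def
      by (simp only: filter_append length_append length_filter_replicate J' meets_iff CF
        finite_classes add.assoc)
  qed
  have ins: "card (insert x I \<inter> A) = Suc (card (I \<inter> A))" "insert x I \<inter> C = I \<inter> C"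
    "insert x I \<inter> B = I \<inter> B" "insert x I \<inter> D = I \<inter> D" "insert x I \<inter> E = I \<inter> E"
    "insert x I \<inter> F = I \<inter> F" if "x \<notin> I" for I
    using that x x' by (auto simp: card_insert_Int)
  have indep: "insert x I \<in> indeps M \<longleftrightarrow>
      Suc (card I) \<le> 2 * k \<and>
      Suc (Suc (card (I \<inter> A) + card (I \<inter> B) + card (I \<inter> D) + card (I \<inter> E))) \<le> 2 * k \<and>
      card (I \<inter> C) + card (I \<inter> B) + card (I \<inter> E) \<le> k + card B \<and>
      card (I \<inter> C) + Suc (card (I \<inter> A)) + card (I \<inter> D) \<le> k + card A \<and>
      card (I \<inter> F) + card (I \<inter> E) + Suc (card (I \<inter> A)) \<le> k + card E \<and>
      card (I \<inter> F) + card (I \<inter> D) + card (I \<inter> B) \<le> k + card D"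
    if I: "I \<subseteq> ground M - {x}" for I
  proof -
    have "x \<notin> I" "insert x I \<subseteq> ground M" using I xg by auto
    moreover have "card (insert x I) = Suc (card I)"
      using \<open>x \<notin> I\<close> I finite_ground by (metis card_insert_disjoint finite_Diff finite_subset)
    moreover have "n \<le> 2 * k - 1 \<longleftrightarrow> Suc n \<le> 2 * k" for n using class_sizes(1,5) by linarith
    ultimately show ?thesis unfolding indep_iff by (simp add: ins)
  qed
  have "insert x I \<in> indeps M \<longleftrightarrow> partial_transversal Ss I" if I: "I \<subseteq> ground M - {x}" for I
  proof
    assume ind: "insert x I \<in> indeps M"
    have "card J \<le> ?m J" if J: "J \<subseteq> I" for J
    proof -
      have Jg: "J \<subseteq> ground M - {x}" using J I by blast
      have cJ: "card J = card (J \<inter> A) + card (J \<inter> B) + card (J \<inter> C) + card (J \<inter> D)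
          + card (J \<inter> E) + card (J \<inter> F)"
        using Jg by (intro card_eq_sum) blast
      have "insert x J \<in> indeps M" using J by (intro indep_subset[OF ind]) blast
      note indepJ = this[unfolded indep[OF Jg] cJ]
      have "card (insert x J \<inter> A) \<le> card A" by (rule card_Int_le)
      moreover have "x \<notin> J" using Jg by blast
      ultimately have "Suc (card (J \<inter> A)) \<le> card A" using ins(1) by simp
      then show ?thesis
        unfolding m[OF Jg] unfolding cJ
        by (intro Hall_count_A[OF class_sizes(1,2,5-8)])
          (use indepJ class_sizes(5,8) in \<open>simp_all add: card_Int_le\<close>)
    qed
    then show "partial_transversal Ss I"
      using I finite_ground by (subst partial_transversal_iff_Hall) (auto intro: finite_subset)
  next
    assume "partial_transversal Ss I"
    moreover have "finite I" using I finite_ground by (meson finite_Diff finite_subset)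
    ultimately have hall: "card J \<le> ?m J" if "J \<subseteq> I" for J
      using that partial_transversal_iff_Hall by blast
    have hall_Int: "card (I \<inter> Z) \<le> ?m (I \<inter> Z)" "I \<inter> Z \<subseteq> ground M" "I \<inter> Z \<subseteq> ground M - {x}" for Z
      using hall[of "I \<inter> Z"] I by blast+
    have 1: "Suc (card I) \<le> 2 * k"
      using hall[OF order_refl] length_filter_le[of "\<lambda>S. S \<inter> I \<noteq> {}" Ss] len class_sizes(1,5) by linarith
    have 2: "card (I \<inter> C) + card (I \<inter> B) + card (I \<inter> E) \<le> k + card B"
      using hall_Int(1)[of "C \<union> B \<union> E"] class_sizes
      unfolding m[OF hall_Int(3)] card_eq_sum[OF hall_Int(2)]
      by (simp add: Int_assoc Int_Un_distrib2 split: if_splits)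
    have 3: "card (I \<inter> C) + Suc (card (I \<inter> A)) + card (I \<inter> D) \<le> k + card A"
      using hall_Int(1)[of "C \<union> A \<union> D"] class_sizes
      unfolding m[OF hall_Int(3)] card_eq_sum[OF hall_Int(2)]
      by (simp add: Int_assoc Int_Un_distrib2 split: if_splits)
    have 4: "card (I \<inter> F) + card (I \<inter> E) + Suc (card (I \<inter> A)) \<le> k + card E"
      using hall_Int(1)[of "F \<union> E \<union> A"] class_sizes
      unfolding m[OF hall_Int(3)] card_eq_sum[OF hall_Int(2)]
      by (simp add: Int_assoc Int_Un_distrib2 split: if_splits)
    have 5: "card (I \<inter> F) + card (I \<inter> D) + card (I \<inter> B) \<le> k + card D"
      using hall_Int(1)[of "F \<union> D \<union> B"] class_sizes
      unfolding m[OF hall_Int(3)] card_eq_sum[OF hall_Int(2)]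
      by (simp add: Int_assoc Int_Un_distrib2 split: if_splits)
    have 6: "Suc (Suc (card (I \<inter> A) + card (I \<inter> B) + card (I \<inter> D) + card (I \<inter> E))) \<le> 2 * k"
      using hall_Int(1)[of "A \<union> B \<union> D \<union> E"] class_sizes
      unfolding m[OF hall_Int(3)] card_eq_sum[OF hall_Int(2)]
      by (simp add: Int_assoc Int_Un_distrib2 split: if_splits)
    show "insert x I \<in> indeps M" unfolding indep[OF I] using 1 2 3 4 5 6 by blast
  qed
  moreover have "S \<subseteq> ground M - {x}" if "S \<in> set Ss" for S
    using that x' ground by (auto simp: Ss_def)
  ultimately show "presents Ss (contract M {x})"
    unfolding presents_def contract_singleton[OF xg] by blast
qed

lemma contract_presentation:
  assumes "x \<in> ground M"
  obtains Ss where "length Ss = 2 * k - 1" "presents Ss (contract M {x})"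
proof -
  note rotate2 = M_beta.rotate[OF rotate]
  note rotate3 = M_beta.rotate[OF rotate2]
  consider "x \<in> A" | "x \<in> E" | "x \<in> B" | "x \<in> D" | "x \<in> C" | "x \<in> F"
    using assms ground by blast
  then show thesis
    using that contract_A_presentation[of x] M_beta.contract_A_presentation[OF rotate, of x]
      M_beta.contract_A_presentation[OF rotate2, of x] M_beta.contract_A_presentation[OF rotate3, of x]
      contract_C_presentation[of x] M_beta.contract_C_presentation[OF rotate, of x]
    by cases metis+
qed

end

section \<open>Ordering pairs of bases\<close>

context M_beta
begin

text \<open>The bases of \<open>M\<close> that contain \<open>x\<close> are the full transversals of a presentation of \<open>M/x\<close> together with
  \<open>x\<close>. An exchange of full transversals yields a set of the right size because it fixes the common
  elements.\<close>

lemma intersecting_bases_ordering: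
  assumes B: "B1 \<in> bases M" "B2 \<in> bases M" and x: "x \<in> B1" "x \<in> B2"
  shows "\<exists>\<sigma>. strong_ordering M B1 B2 \<sigma>"
proof -
  have sub: "B1 \<subseteq> ground M" "B2 \<subseteq> ground M"
    using B indep_subset_ground by (auto simp: basis_iff)
  then have xg: "x \<in> ground M" and fin: "finite B1" "finite B2"
    using x finite_ground finite_subset by blast+
  obtain Ss where Ss: "length Ss = 2 * k - 1" "presents Ss (contract M {x})"
    using contract_presentation[OF xg] .
  have pt: "insert x I \<in> indeps M \<longleftrightarrow> partial_transversal Ss I" if "I \<subseteq> ground M - {x}" for I
  proof -
    have "I \<in> indeps (contract M {x}) \<longleftrightarrow> I \<subseteq> ground M - {x} \<and> partial_transversal Ss I"
      using Ss(2) unfolding presents_def contract_singleton(1)[OF xg] by blast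
    then show ?thesis using that contract_singleton(2)[OF xg] by simp
  qed
  define P1 where "P1 = B1 - {x}"
  define P2 where "P2 = B2 - {x}"
  have ins: "insert x P1 = B1" "insert x P2 = B2" using x by (auto simp: P1_def P2_def)
  have Pg: "P1 \<subseteq> ground M - {x}" "P2 \<subseteq> ground M - {x}" using sub by (auto simp: P1_def P2_def)
  have cardP: "card P1 = length Ss" "card P2 = length Ss" and finP: "finite P1" "finite P2"
    using B x fin Ss(1) by (simp_all add: P1_def P2_def basis_iff)
  have "partial_transversal Ss P1" "partial_transversal Ss P2"
    using pt[OF Pg(1)] pt[OF Pg(2)] ins B by (simp_all add: basis_iff)
  from full_transversals_exchange[OF this finP cardP]
  obtain \<tau> where \<tau>: "bij_betw \<tau> P1 P2" and fixed: "\<forall>z\<in>P1 \<inter> P2. \<tau> z = z"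
    and ex: "\<forall>X\<subseteq>P1. partial_transversal Ss ((P1 - X) \<union> \<tau> ` X)" by blast
  have \<tau>_bij: "inj_on \<tau> P1" "\<tau> ` P1 = P2" using \<tau> by (auto simp: bij_betw_def)
  have xP: "x \<notin> P1" "x \<notin> P2" by (auto simp: P1_def P2_def)
  define \<sigma> where "\<sigma> = \<tau>(x := x)"
  have \<sigma>\<tau>: "\<sigma> ` X = \<tau> ` X" if "X \<subseteq> P1" for X
    unfolding \<sigma>_def using that xP by (intro image_cong) auto
  have \<sigma>x: "\<sigma> x = x" by (simp add: \<sigma>_def)
  have "strong_ordering M B1 B2 \<sigma>"
    unfolding strong_ordering_def
  proof (intro conjI allI impI)
    have "inj_on \<sigma> P1 \<longleftrightarrow> inj_on \<tau> P1" using xP by (intro inj_on_cong) (auto simp: \<sigma>_def)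
    then have "inj_on \<sigma> P1" using \<tau>_bij(1) by simp
    moreover have "\<sigma> x \<notin> \<sigma> ` P1" using \<sigma>\<tau>[of P1] \<tau>_bij(2) xP by (simp add: \<sigma>_def)
    ultimately have "inj_on \<sigma> (insert x P1)" using xP(1) by simp
    moreover have "\<sigma> ` insert x P1 = insert x P2"
      by (simp only: image_insert \<sigma>x \<sigma>\<tau>[OF order_refl] \<tau>_bij(2))
    ultimately show "bij_betw \<sigma> B1 B2" unfolding bij_betw_def by (simp only: ins)
  next
    fix X assume X: "X \<subseteq> B1"
    define Y where "Y = X - {x}"
    have Y: "Y \<subseteq> P1" using X by (auto simp: Y_def P1_def)
    define T where "T = (P1 - Y) \<union> \<tau> ` Y"
    have Tg: "T \<subseteq> ground M - {x}" using Y \<tau>_bij(2) Pg by (auto simp: T_def)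
    have "(P1 - Y) \<inter> \<tau> ` Y = {}"
    proof (rule ccontr)
      assume "(P1 - Y) \<inter> \<tau> ` Y \<noteq> {}"
      then obtain y where y: "y \<in> Y" "\<tau> y \<in> P1" "\<tau> y \<notin> Y" by blast
      then have "\<tau> y \<in> P1 \<inter> P2" "y \<in> P1" using Y \<tau>_bij(2) by auto
      then have "\<tau> (\<tau> y) = \<tau> y" using fixed by blast
      then have "\<tau> y = y" using \<tau>_bij(1) \<open>y \<in> P1\<close> y(2) by (meson inj_onD)
      then show False using y by simp
    qed
    then have "card T = card (P1 - Y) + card (\<tau> ` Y)"
      unfolding T_def using finP(1) Y by (intro card_Un_disjoint) (auto intro: finite_subset)
    also have "card (\<tau> ` Y) = card Y" using \<tau>_bij(1) Y by (intro card_image) (rule inj_on_subset)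
    also have "card (P1 - Y) + card Y = card P1"
      using Y finP(1) by (simp add: card_Diff_subset finite_subset card_mono)
    finally have "card T = card P1" .
    then have "card (insert x T) = card B1"
      using Tg finite_ground finP(1) xP ins(1)
      by (metis Diff_iff card_insert_disjoint finite_Diff finite_subset insertI1 subsetD)
    moreover have "insert x T \<in> indeps M" using ex Y pt[OF Tg] by (simp add: T_def)
    ultimately have "insert x T \<in> bases M" using B(1) by (simp add: basis_iff)
    moreover have "(B1 - X) \<union> \<sigma> ` X = insert x T"
    proof (cases "x \<in> X")
      case True
      then have "X = insert x Y" by (auto simp: Y_def)
      moreover have "\<sigma> ` insert x Y = insert x (\<tau> ` Y)" by (simp only: image_insert \<sigma>x \<sigma>\<tau>[OF Y])
      moreover have "B1 - insert x Y = P1 - Y" by (auto simp: P1_def)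
      ultimately show ?thesis by (simp add: T_def)
    next
      case False
      then have "X = Y" by (auto simp: Y_def)
      moreover have "B1 - Y = insert x (P1 - Y)" using x by (auto simp: P1_def Y_def)
      ultimately show ?thesis using \<sigma>\<tau>[OF Y] by (simp add: T_def)
    qed
    ultimately show "(B1 - X) \<union> \<sigma> ` X \<in> bases M" by simp
  qed
  then show ?thesis by blast
qed

text \<open>Independence depends only on how many elements of each class a set has, so elements of the same
  class are clones.\<close>

lemma clone_exchange:
  assumes W: "W \<in> bases M" and P: "P \<in> {A, B, C, D, E, F}" and xy: "x \<in> P" "y \<in> P" "x \<in> W" "y \<notin> W"
  shows "insert y (W - {x}) \<in> bases M"
proof -
  let ?V = "insert y (W - {x})"
  have Pg: "P \<subseteq> ground M" using P ground by auto
  have Wg: "W \<subseteq> ground M" using W indep_subset_ground by (simp add: basis_iff)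
  have Vg: "?V \<subseteq> ground M" using Pg Wg xy by blast
  have eq: "card (?V \<inter> Q) = card (W \<inter> Q)" if Q: "Q \<in> {A, B, C, D, E, F}" for Q
  proof (cases "Q = P")
    case True
    have "finite P" using P by auto
    have "?V \<inter> P = insert y (W \<inter> P - {x})" using xy by blast
    also have "card \<dots> = Suc (card (W \<inter> P - {x}))" using xy \<open>finite P\<close> by simp
    also have "\<dots> = card (W \<inter> P)" using xy \<open>finite P\<close> by (intro card_Suc_Diff1) auto
    finally show ?thesis using True by simp
  next
    case False
    moreover have "pairwise disjnt {A, B, C, D, E, F}" using tuple by (simp add: beta_tuple_def)
    ultimately have "P \<inter> Q = {}" using pairwiseD[of disjnt _ Q P] P Q by (auto simp: disjnt_def)
    then have "?V \<inter> Q = W \<inter> Q" using xy by blast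
    then show ?thesis by simp
  qed
  have "card ?V = card W" using card_eq_sum[OF Vg] card_eq_sum[OF Wg] by (simp add: eq)
  then show ?thesis using W Vg Wg unfolding basis_iff indep_iff by (simp only: eq insert_iff simp_thms)
qed

text \<open>A class with elements \<open>x\<close> of \<open>B1\<close> and \<open>y\<close> of \<open>B2\<close> reduces the pair to an intersecting one: replace \<open>y\<close>
  by its clone \<open>x\<close> in \<open>B2\<close>, order, and let \<open>y\<close> stand for \<open>x\<close> again.\<close>

lemma split_class_ordering:
  assumes B: "B1 \<in> bases M" "B2 \<in> bases M" "B1 \<inter> B2 = {}"
    and P: "P \<in> {A, B, C, D, E, F}" and xy: "x \<in> P \<inter> B1" "y \<in> P \<inter> B2"
  shows "\<exists>\<sigma>. strong_ordering M B1 B2 \<sigma>"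
proof -
  define B3 where "B3 = insert x (B2 - {y})"
  have xB2: "x \<notin> B2" and yB1: "y \<notin> B1" using B(3) xy by blast+
  have "B3 \<in> bases M"
    unfolding B3_def using clone_exchange[OF B(2) P] xy xB2 by blast
  then obtain \<tau> where \<tau>: "strong_ordering M B1 B3 \<tau>"
    using intersecting_bases_ordering[OF B(1), of B3 x] xy by (auto simp: B3_def)
  have \<tau>x: "\<tau> x = x" using strong_ordering_fixes[OF \<tau>] xy by (simp add: B3_def)
  have inj: "inj_on \<tau> B1" and img: "\<tau> ` B1 = B3"
    using \<tau> by (auto simp: strong_ordering_def bij_betw_def)
  have yB3: "y \<notin> B3" using xy yB1 by (auto simp: B3_def)
  define \<sigma> where "\<sigma> = \<tau>(x := y)"
  have \<sigma>\<tau>: "\<sigma> ` X = \<tau> ` X" if "x \<notin> X" for X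
    unfolding \<sigma>_def using that by (intro image_cong) auto
  have img': "\<tau> ` (X - {x}) = \<tau> ` X - {x}" if "X \<subseteq> B1" for X
    using that inj_onD[OF inj, of _ x] xy \<tau>x by fastforce
  have "strong_ordering M B1 B2 \<sigma>"
    unfolding strong_ordering_def
  proof (intro conjI allI impI)
    have B1: "insert x (B1 - {x}) = B1" using xy by blast
    have "\<sigma> ` (B1 - {x}) = B2 - {y}"
      using \<sigma>\<tau>[of "B1 - {x}"] img'[of B1] img xB2 by (auto simp: B3_def)
    then have "\<sigma> ` B1 = B2"
      using xy by (metis B1 Int_iff \<sigma>_def fun_upd_same image_insert insert_Diff)
    moreover have "inj_on \<sigma> B1"
      unfolding \<sigma>_def using inj img yB3 by (intro inj_on_fun_updI) auto
    ultimately show "bij_betw \<sigma> B1 B2" by (simp add: bij_betw_def)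
  next
    fix X assume X: "X \<subseteq> B1"
    have U: "(B1 - X) \<union> \<tau> ` X \<in> bases M" using \<tau> X by (simp add: strong_ordering_def)
    show "(B1 - X) \<union> \<sigma> ` X \<in> bases M"
    proof (cases "x \<in> X")
      case False
      then show ?thesis using U \<sigma>\<tau> by simp
    next
      case True
      let ?U = "(B1 - X) \<union> \<tau> ` X"
      have "x \<in> ?U" using True \<tau>x by force
      moreover have "y \<notin> ?U" using yB1 yB3 img X by blast
      ultimately have "insert y (?U - {x}) \<in> bases M"
        using clone_exchange[OF U P] xy by blast
      moreover have "\<sigma> ` X = insert y (\<sigma> ` (X - {x}))"
        using True by (metis \<sigma>_def fun_upd_same image_insert insert_Diff)
      then have "\<sigma> ` X = insert y (\<tau> ` X - {x})" using \<sigma>\<tau>[of "X - {x}"] img'[OF X] by simp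
      then have "(B1 - X) \<union> \<sigma> ` X = insert y (?U - {x})" using True by blast
      ultimately show ?thesis by simp
    qed
  qed
  then show ?thesis by blast
qed

text \<open>In each case the first two sets already contain as many elements of a flat as its rank allows.\<close>

lemma tight_flats:
  assumes "W \<in> indeps M"
  shows "C \<subseteq> W \<Longrightarrow> B \<subseteq> W \<Longrightarrow> W \<inter> E = {}" and "C \<subseteq> W \<Longrightarrow> A \<subseteq> W \<Longrightarrow> W \<inter> D = {}"
    and "F \<subseteq> W \<Longrightarrow> E \<subseteq> W \<Longrightarrow> W \<inter> A = {}" and "F \<subseteq> W \<Longrightarrow> D \<subseteq> W \<Longrightarrow> W \<inter> B = {}"
  using assms class_sizes(3,4) unfolding indep_iff by (auto simp: Int_absorb1)

lemma hyperplane_not_indep: "A \<union> B \<union> D \<union> E \<notin> indeps M"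
proof
  assume "A \<union> B \<union> D \<union> E \<in> indeps M"
  then have "card A + card B + card D + card E \<le> 2 * k - 1"
    unfolding indep_iff by (simp add: Int_Un_distrib2)
  then show False using class_sizes by linarith
qed

text \<open>If no class is split, the pair consists of two unions of classes. Neither of them is \<open>C \<union> F\<close>, as the
  other one would be the hyperplane. The four flats that contain \<open>C\<close> or \<open>F\<close> then allow only two pairs, the second one
  only when \<open>A\<close>, \<open>B\<close>, \<open>D\<close>, \<open>E\<close> all have the same size.\<close>

lemma unsplit_pair:
  assumes B1: "B1 \<in> bases M" and B2: "B2 \<in> bases M" and disj: "B1 \<inter> B2 = {}"
    and unsplit: "\<And>P. P \<in> {A, B, C, D, E, F} \<Longrightarrow> P \<inter> B1 = {} \<or> P \<inter> B2 = {}"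
    and C1: "C \<inter> B2 = {}"
  shows "B1 = A \<union> B \<union> C \<and> B2 = D \<union> E \<union> F \<or>
    card A = card B \<and> card B = card D \<and> card D = card E \<and> B1 = D \<union> E \<union> C \<and> B2 = A \<union> B \<union> F"
proof -
  have I: "B1 \<in> indeps M" "B2 \<in> indeps M" and card12: "card B1 = 2 * k" "card B2 = 2 * k"
    using B1 B2 by (simp_all add: basis_iff)
  have sub: "B1 \<subseteq> ground M" "B2 \<subseteq> ground M" using I indep_subset_ground by auto
  have "B1 \<union> B2 = ground M"
  proof (rule card_subset_eq)
    have "card (ground M) = 4 * k" using card_eq_sum[of "ground M"] class_sizes by (simp add: ground Int_Un_distrib2)
    then show "card (B1 \<union> B2) = card (ground M)"
      using card_Un_disjoint[of B1 B2] disj I finite_indep card12 by simp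
  qed (use sub finite_ground in auto)
  then have cover: "P \<subseteq> B1 \<union> B2" if "P \<in> {A, B, C, D, E, F}" for P
    using that ground by auto
  have cls: "P \<inter> B2 = {} \<and> P \<subseteq> B1 \<or> P \<inter> B1 = {} \<and> P \<subseteq> B2" if "P \<in> {A, B, C, D, E, F}" for P
    using cover[OF that] unsplit[OF that] by blast
  have ne: "A \<noteq> {}" "B \<noteq> {}" "C \<noteq> {}" "D \<noteq> {}" "E \<noteq> {}" "F \<noteq> {}"
    using tuple by (auto simp: beta_tuple_def)
  have C: "C \<subseteq> B1" using cls[of C] C1 cover[of C] by blast
  have F: "F \<inter> B1 = {} \<and> F \<subseteq> B2"
  proof (rule ccontr)
    assume "\<not> (F \<inter> B1 = {} \<and> F \<subseteq> B2)"
    then have "C \<union> F \<subseteq> B1" using cls[of F] C by blast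
    moreover have "card (C \<union> F) = 2 * k" using class_sizes by (simp add: card_Un_disjoint)
    ultimately have "C \<union> F = B1" using card12(1) finite_indep[OF I(1)] by (intro card_subset_eq) auto
    then have in_B2: "P \<subseteq> B2" if "P \<inter> (C \<union> F) = {}" "P \<subseteq> B1 \<union> B2" for P using that by blast
    have "A \<subseteq> B2" "B \<subseteq> B2" "D \<subseteq> B2" "E \<subseteq> B2"
      by (rule in_B2, simp add: Int_Un_distrib, rule cover, simp)+
    then have "A \<union> B \<union> D \<union> E \<subseteq> B2" by simp
    then show False using I(2) indep_subset hyperplane_not_indep by blast
  qed
  note tight1 = tight_flats(1,2)[OF I(1) C]
  note tight2 = tight_flats(3,4)[OF I(2) conjunct2[OF F]]
  have A: "A \<inter> B2 = {} \<and> A \<subseteq> B1 \<or> A \<inter> B1 = {} \<and> A \<subseteq> B2"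
    and B: "B \<inter> B2 = {} \<and> B \<subseteq> B1 \<or> B \<inter> B1 = {} \<and> B \<subseteq> B2"
    and D: "D \<inter> B2 = {} \<and> D \<subseteq> B1 \<or> D \<inter> B1 = {} \<and> D \<subseteq> B2"
    and E: "E \<inter> B2 = {} \<and> E \<subseteq> B1 \<or> E \<inter> B1 = {} \<and> E \<subseteq> B2"
    using cls by simp_all
  have AD: "D \<subseteq> B2" if "A \<subseteq> B1" using tight1(2)[OF that] D ne(4) by blast
  have BE: "E \<subseteq> B2" if "B \<subseteq> B1" using tight1(1)[OF that] E ne(5) by blast
  have EA: "A \<subseteq> B1" if "E \<subseteq> B2" using tight2(1)[OF that] A ne(1) by blast
  have DB: "B \<subseteq> B1" if "D \<subseteq> B2" using tight2(2)[OF that] B ne(2) by blast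
  have B1g: "B1 \<subseteq> A \<union> B \<union> C \<union> D \<union> E \<union> F" and B2g: "B2 \<subseteq> A \<union> B \<union> C \<union> D \<union> E \<union> F"
    using sub ground by simp_all
  show ?thesis
  proof (cases "A \<subseteq> B1")
    case True
    then have "D \<subseteq> B2" "B \<subseteq> B1" "E \<subseteq> B2" using AD BE DB by blast+
    then have sub: "A \<subseteq> B1" "B \<subseteq> B1" "D \<subseteq> B2" "E \<subseteq> B2" using True by simp_all
    then have "A \<inter> B2 = {}" "B \<inter> B2 = {}" "D \<inter> B1 = {}" "E \<inter> B1 = {}"
      using disj by blast+
    then have "B1 \<subseteq> A \<union> B \<union> C" "B2 \<subseteq> D \<union> E \<union> F"
      using B1g B2g C1 conjunct1[OF F] by blast+
    then have "B1 = A \<union> B \<union> C" "B2 = D \<union> E \<union> F"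
      using sub C conjunct2[OF F] by (simp_all add: subset_antisym)
    then show ?thesis by blast
  next
    case False
    then have AE: "A \<subseteq> B2" "A \<inter> B1 = {}" "E \<subseteq> B1" "E \<inter> B2 = {}" using A E EA by auto
    then have "\<not> E \<subseteq> B2" using ne(5) by blast
    then have BD: "B \<subseteq> B2" "B \<inter> B1 = {}" "D \<subseteq> B1" "D \<inter> B2 = {}" using B D BE DB by auto
    have "B1 \<subseteq> D \<union> E \<union> C" using B1g AE(2) BD(2) conjunct1[OF F] by blast
    moreover have "B2 \<subseteq> A \<union> B \<union> F" using B2g AE(4) BD(4) C1 by blast
    ultimately have eq: "B1 = D \<union> E \<union> C" "B2 = A \<union> B \<union> F"
      using AE(1,3) BD(1,3) C conjunct2[OF F] by (simp_all add: subset_antisym)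
    have "card E \<le> card B" "card D \<le> card A"
      using I(1) class_sizes(3) unfolding eq indep_iff by (simp_all add: Int_Un_distrib2)
    moreover have "card A \<le> card E" "card B \<le> card D"
      using I(2) class_sizes(4) unfolding eq indep_iff by (simp_all add: Int_Un_distrib2)
    ultimately show ?thesis using eq by linarith
  qed
qed

lemma ordering_or_exceptional_pair:
  assumes "B1 \<in> bases M" "B2 \<in> bases M"
  shows "(\<exists>\<sigma>. strong_ordering M B1 B2 \<sigma>) \<or> {B1, B2} = {A \<union> B \<union> C, D \<union> E \<union> F} \<or>
    card A = card B \<and> card B = card D \<and> card D = card E \<and> {B1, B2} = {D \<union> E \<union> C, A \<union> B \<union> F}"
proof (cases "B1 \<inter> B2 = {} \<and> (\<forall>P\<in>{A, B, C, D, E, F}. P \<inter> B1 = {} \<or> P \<inter> B2 = {})")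
  case True
  then have unsplit: "P \<inter> B1 = {} \<or> P \<inter> B2 = {}" if "P \<in> {A, B, C, D, E, F}" for P
    using that by blast
  have "C \<inter> B2 = {} \<or> C \<inter> B1 = {}" using unsplit[of C] by blast
  then show ?thesis
  proof
    assume "C \<inter> B2 = {}"
    then show ?thesis using unsplit_pair[OF assms(1,2) _ unsplit] True by auto
  next
    assume "C \<inter> B1 = {}"
    then have "B2 = A \<union> B \<union> C \<and> B1 = D \<union> E \<union> F \<or>
      card A = card B \<and> card B = card D \<and> card D = card E \<and> B2 = D \<union> E \<union> C \<and> B1 = A \<union> B \<union> F"
      using True unsplit by (intro unsplit_pair[OF assms(2,1)]) (auto simp: Int_commute)
    then show ?thesis by (auto simp: insert_commute)
  qed
next
  case False
  then consider x where "x \<in> B1" "x \<in> B2"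
    | P x y where "B1 \<inter> B2 = {}" "P \<in> {A, B, C, D, E, F}" "x \<in> P \<inter> B1" "y \<in> P \<inter> B2"
    by blast
  then have "\<exists>\<sigma>. strong_ordering M B1 B2 \<sigma>"
  proof cases
    case 1
    then show ?thesis by (rule intersecting_bases_ordering[OF assms])
  next
    case 2
    then show ?thesis by (rule split_class_ordering[OF assms])
  qed
  then show ?thesis ..
qed

section \<open>The exceptional pair\<close>

lemma exceptional_bases: "A \<union> B \<union> C \<in> bases M" "D \<union> E \<union> F \<in> bases M"
proof -
  have "card (A \<union> B \<union> C) = 2 * k" "card (D \<union> E \<union> F) = 2 * k"
    using class_sizes by (simp_all add: card_Un_disjoint Int_Un_distrib2)
  then show "A \<union> B \<union> C \<in> bases M" "D \<union> E \<union> F \<in> bases M"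
    using class_sizes ground unfolding basis_iff indep_iff by (auto simp: Int_Un_distrib2)
qed

text \<open>The base \<open>A \<union> B \<union> C\<close> spans \<open>C \<union> B \<union> E\<close> and \<open>C \<union> A \<union> D\<close>, and \<open>D \<union> E \<union> F\<close> spans \<open>F \<union> E \<union> A\<close> and \<open>F \<union> D \<union> B\<close>. So
  exchanging an element of \<open>A \<union> B\<close> for one of \<open>D \<union> E\<close> makes one of the two bases dependent, and an
  ordering maps \<open>A \<union> B\<close> to \<open>F\<close>. Hence \<open>C\<close> goes to \<open>D \<union> E\<close>, and exchanging all of \<open>C\<close>
  yields the dependent set \<open>A \<union> B \<union> D \<union> E\<close>.\<close>

lemma exceptional_pair_no_ordering:
  "\<not> exchange_ordering k M (A \<union> B \<union> C) (D \<union> E \<union> F) \<sigma>"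
proof
  let ?B1 = "A \<union> B \<union> C" and ?B2 = "D \<union> E \<union> F"
  assume \<sigma>: "exchange_ordering k M ?B1 ?B2 \<sigma>"
  have inj: "inj_on \<sigma> ?B1" and img: "\<sigma> ` ?B1 = ?B2"
    using \<sigma> by (auto simp: exchange_ordering_def bij_betw_def)
  have ex: "(?B1 - X) \<union> \<sigma> ` X \<in> indeps M" "(?B2 - \<sigma> ` X) \<union> X \<in> indeps M"
    if "X \<subseteq> ?B1" "card X \<le> k" for X
    using \<sigma> that by (auto simp: exchange_ordering_def basis_iff)
  have dj: "x \<notin> Q" if "x \<in> P" "P \<inter> Q = {}" for x and P Q :: "'a set" using that by blast
  have "\<sigma> x \<in> F" if x: "x \<in> A \<union> B" for x
  proof (rule ccontr)
    assume "\<sigma> x \<notin> F"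
    then have y: "\<sigma> x \<in> D \<or> \<sigma> x \<in> E" using img x by blast
    have W: "(?B1 - {x}) \<union> {\<sigma> x} \<in> indeps M" "(?B2 - {\<sigma> x}) \<union> {x} \<in> indeps M"
      using ex[of "{x}"] x class_sizes by auto
    have "x \<notin> C" using dj[OF x, of C] by (simp add: Int_Un_distrib2)
    then have C: "C \<subseteq> (?B1 - {x}) \<union> {\<sigma> x}" and F: "F \<subseteq> (?B2 - {\<sigma> x}) \<union> {x}"
      using \<open>\<sigma> x \<notin> F\<close> by auto
    from x y consider "x \<in> A" "\<sigma> x \<in> E" | "x \<in> B" "\<sigma> x \<in> D" | "x \<in> A" "\<sigma> x \<in> D" | "x \<in> B" "\<sigma> x \<in> E"
      by blast
    then show False
    proof cases
      case 1
      then have "B \<subseteq> (?B1 - {x}) \<union> {\<sigma> x}" using dj[of x A B] by auto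
      then show False using tight_flats(1)[OF W(1) C] 1 by blast
    next
      case 2
      then have "A \<subseteq> (?B1 - {x}) \<union> {\<sigma> x}" using dj[of x B A] by auto
      then show False using tight_flats(2)[OF W(1) C] 2 by blast
    next
      case 3
      then have "E \<subseteq> (?B2 - {\<sigma> x}) \<union> {x}" using dj[of "\<sigma> x" D E] by auto
      then show False using tight_flats(3)[OF W(2) F] 3 by blast
    next
      case 4
      then have "D \<subseteq> (?B2 - {\<sigma> x}) \<union> {x}" using dj[of "\<sigma> x" E D] by auto
      then show False using tight_flats(4)[OF W(2) F] 4 by blast
    qed
  qed
  then have "\<sigma> ` (A \<union> B) \<subseteq> F" by blast
  moreover have "card (\<sigma> ` (A \<union> B)) = card F"
    using class_sizes inj_on_subset[OF inj, of "A \<union> B"] by (simp add: card_image card_Un_disjoint)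
  ultimately have AB: "\<sigma> ` (A \<union> B) = F" by (intro card_subset_eq) auto
  have "\<sigma> ` C \<inter> \<sigma> ` (A \<union> B) = {}"
    using inj_on_image_Int[OF inj, of C "A \<union> B"] by (auto simp: Int_Un_distrib)
  then have "\<sigma> ` C \<inter> F = {}" by (simp only: AB)
  moreover have "\<sigma> ` C \<union> F = D \<union> E \<union> F" using img AB by (metis image_Un sup_commute)
  moreover have "(D \<union> E) \<inter> F = {}" by (simp add: Int_Un_distrib2)
  ultimately have C: "\<sigma> ` C = D \<union> E" by blast
  have "?B1 - C = A \<union> B" by (simp add: Un_Diff Diff_triv)
  moreover have "(?B1 - C) \<union> \<sigma> ` C \<in> indeps M" using class_sizes by (intro ex(1)) auto
  ultimately have "A \<union> B \<union> (D \<union> E) \<in> indeps M" by (simp only: C)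
  then show False using hyperplane_not_indep Un_assoc[of "A \<union> B" D E] by metis
qed

text \<open>A bijection that maps \<open>C\<close> to \<open>D \<union> E\<close> and \<open>A \<union> B\<close> to \<open>F\<close> respects the ranks of the four flats that
  contain \<open>C\<close> or \<open>F\<close>, for every set \<open>X\<close> of exchanged elements. It produces the hyperplane only when \<open>X\<close> is \<open>C\<close> or \<open>A \<union> B\<close>, which have \<open>k\<close>
  elements.\<close>

lemma exceptional_pair_small_ordering:
  "\<exists>\<sigma>. exchange_ordering (k - 1) M (A \<union> B \<union> C) (D \<union> E \<union> F) \<sigma>"
proof -
  let ?B1 = "A \<union> B \<union> C" and ?B2 = "D \<union> E \<union> F"
  have "card C = card (D \<union> E)" "card (A \<union> B) = card F"
    using class_sizes by (simp_all add: card_Un_disjoint)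
  then obtain f g where f: "bij_betw f C (D \<union> E)" and g: "bij_betw g (A \<union> B) F"
    by (metis finite_Un finite_classes finite_same_card_bij)
  define \<sigma> where "\<sigma> x = (if x \<in> C then f x else g x)" for x
  have AB_C: "(A \<union> B) \<inter> C = {}" and DE_F: "(D \<union> E) \<inter> F = {}" by (simp_all add: Int_Un_distrib2)
  have \<sigma>C: "bij_betw \<sigma> C (D \<union> E)" using f by (simp add: \<sigma>_def cong: bij_betw_cong)
  have "bij_betw \<sigma> (A \<union> B) F \<longleftrightarrow> bij_betw g (A \<union> B) F"
    using AB_C by (intro bij_betw_cong) (auto simp: \<sigma>_def)
  then have \<sigma>AB: "bij_betw \<sigma> (A \<union> B) F" using g by simp
  have bij: "bij_betw \<sigma> ?B1 ?B2"
  proof -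
    have "bij_betw \<sigma> ((A \<union> B) \<union> C) (F \<union> (D \<union> E))"
      using \<sigma>AB \<sigma>C DE_F by (intro bij_betw_combine) auto
    then show ?thesis by (simp add: Un_commute Un_left_commute)
  qed
  have inj: "inj_on \<sigma> ?B1" and img: "\<sigma> ` ?B1 = ?B2" using bij by (auto simp: bij_betw_def)
  have "(?B1 - X) \<union> \<sigma> ` X \<in> bases M \<and> (?B2 - \<sigma> ` X) \<union> X \<in> bases M"
    if X: "X \<subseteq> ?B1" "card X \<le> k - 1" for X
  proof -
    define Y where "Y = \<sigma> ` X"
    let ?W = "(?B1 - X) \<union> Y" and ?V = "(?B2 - Y) \<union> X"
    have Y: "Y \<subseteq> ?B2" using X(1) img by (auto simp: Y_def)
    have Xg: "X \<subseteq> ground M" and Yg: "Y \<subseteq> ground M" using X(1) Y ground by auto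
    have XY: "X \<inter> D = {}" "X \<inter> E = {}" "X \<inter> F = {}" "Y \<inter> A = {}" "Y \<inter> B = {}" "Y \<inter> C = {}"
    proof -
      have "?B1 \<inter> ?B2 = {}" by (simp add: Int_Un_distrib Int_Un_distrib2)
      then show "X \<inter> D = {}" "X \<inter> E = {}" "X \<inter> F = {}" "Y \<inter> A = {}" "Y \<inter> B = {}" "Y \<inter> C = {}"
        using X(1) Y by blast+
    qed
    have "Y \<inter> F = \<sigma> ` (X \<inter> (A \<union> B))" "Y \<inter> (D \<union> E) = \<sigma> ` (X \<inter> C)"
    proof -
      have 1: "Y = \<sigma> ` (X \<inter> (A \<union> B)) \<union> \<sigma> ` (X \<inter> C)" unfolding Y_def using X(1) by blast
      have 2: "\<sigma> ` (X \<inter> (A \<union> B)) \<subseteq> F" "\<sigma> ` (X \<inter> C) \<subseteq> D \<union> E"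
        using \<sigma>AB \<sigma>C by (auto simp: bij_betw_def)
      show "Y \<inter> F = \<sigma> ` (X \<inter> (A \<union> B))" "Y \<inter> (D \<union> E) = \<sigma> ` (X \<inter> C)"
        using 1 2 DE_F by blast+
    qed
    moreover have "card (\<sigma> ` Z) = card Z" if "Z \<subseteq> ?B1" for Z
      using inj that by (intro card_image) (rule inj_on_subset)
    moreover have "X \<inter> (A \<union> B) \<subseteq> ?B1" "X \<inter> C \<subseteq> ?B1" using X(1) by blast+
    ultimately have "card (Y \<inter> F) = card (X \<inter> (A \<union> B))" "card (Y \<inter> (D \<union> E)) = card (X \<inter> C)"
      by simp_all
    moreover have "card (X \<inter> (A \<union> B)) = card (X \<inter> A) + card (X \<inter> B)"
      "card (Y \<inter> (D \<union> E)) = card (Y \<inter> D) + card (Y \<inter> E)"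
      using card_Int_Un3[of A B "{}" X] card_Int_Un3[of D E "{}" Y] by simp_all
    ultimately have y: "card (Y \<inter> F) = card (X \<inter> A) + card (X \<inter> B)"
      "card (Y \<inter> D) + card (Y \<inter> E) = card (X \<inter> C)" by simp_all
    have rest: "card ((Z - S) \<inter> P) + card (S \<inter> P) = card P" if "P \<subseteq> Z" "finite P" for Z S P :: "'a set"
    proof -
      have "card ((Z - S) \<inter> P \<union> S \<inter> P) = card ((Z - S) \<inter> P) + card (S \<inter> P)"
        using that(2) by (intro card_Un_disjoint) auto
      moreover have "(Z - S) \<inter> P \<union> S \<inter> P = P" using that(1) by blast
      ultimately show ?thesis by simp
    qed
    have W1: "?W \<inter> A = (?B1 - X) \<inter> A" "?W \<inter> B = (?B1 - X) \<inter> B" "?W \<inter> C = (?B1 - X) \<inter> C"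
      using XY by blast+
    have W2: "?W \<inter> D = Y \<inter> D" "?W \<inter> E = Y \<inter> E" "?W \<inter> F = Y \<inter> F"
      and V2: "?V \<inter> A = X \<inter> A" "?V \<inter> B = X \<inter> B" "?V \<inter> C = X \<inter> C"
    proof -
      have "?B1 \<inter> D = {}" "?B1 \<inter> E = {}" "?B1 \<inter> F = {}" "?B2 \<inter> A = {}" "?B2 \<inter> B = {}" "?B2 \<inter> C = {}"
        by (simp_all add: Int_Un_distrib2)
      then show "?W \<inter> D = Y \<inter> D" "?W \<inter> E = Y \<inter> E" "?W \<inter> F = Y \<inter> F"
        "?V \<inter> A = X \<inter> A" "?V \<inter> B = X \<inter> B" "?V \<inter> C = X \<inter> C" by blast+
    qed
    have V1: "?V \<inter> D = (?B2 - Y) \<inter> D" "?V \<inter> E = (?B2 - Y) \<inter> E" "?V \<inter> F = (?B2 - Y) \<inter> F"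
      using XY by blast+
    have w: "card (?W \<inter> A) + card (X \<inter> A) = card A" "card (?W \<inter> B) + card (X \<inter> B) = card B"
      "card (?W \<inter> C) + card (X \<inter> C) = k"
      unfolding W1 using rest[of A ?B1 X] rest[of B ?B1 X] rest[of C ?B1 X] class_sizes by auto
    have v: "card (?V \<inter> D) + card (Y \<inter> D) = card D" "card (?V \<inter> E) + card (Y \<inter> E) = card E"
      "card (?V \<inter> F) + card (Y \<inter> F) = k"
      unfolding V1 using rest[of D ?B2 Y] rest[of E ?B2 Y] rest[of F ?B2 Y] class_sizes by auto
    have Wg: "?W \<subseteq> ground M" and Vg: "?V \<subseteq> ground M" using Xg Yg ground by auto
    have xC: "card (X \<inter> A) + card (X \<inter> B) + card (X \<inter> C) \<le> k - 1"
      using X(2) card_eq_sum[OF Xg] by (simp add: XY)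
    have k: "0 < k" using class_sizes by linarith
    have "?W \<in> bases M"
      unfolding basis_iff indep_iff card_eq_sum[OF Wg] W2
      by (intro conjI Wg; use w v y xC k class_sizes(1,2) in linarith)
    moreover have "?V \<in> bases M"
      unfolding basis_iff indep_iff card_eq_sum[OF Vg] V2
      by (intro conjI Vg; use v w y xC k class_sizes(1,2) in linarith)
    ultimately show ?thesis by (simp add: Y_def)
  qed
  then show ?thesis using bij by (auto simp: exchange_ordering_def)
qed

text \<open>With four classes of the same size, \<open>A \<union> B\<close> and \<open>D \<union> E\<close> can change places, which turns the second
  exceptional pair into the first.\<close>

lemma swap_halves:
  assumes "card A = card B" "card B = card D" "card D = card E"
  shows "M_beta k D E C A B F M"
proof
  have perm: "{D, E, C, A, B, F} = {A, B, C, D, E, F}" by blast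
  have "distinct [A, B, C, D, E, F]" using tuple by (simp add: beta_tuple_def)
  then have "distinct [D, E, C, A, B, F]" by simp (metis)
  then show "beta_tuple k D E C A B F"
    using tuple unfolding beta_tuple_def perm by simp
  have "ground M = D \<union> E \<union> C \<union> A \<union> B \<union> F" "D \<union> E \<union> A \<union> B = A \<union> B \<union> D \<union> E"
    "C \<union> E \<union> B = C \<union> B \<union> E" "C \<union> D \<union> A = C \<union> A \<union> D" "F \<union> B \<union> D = F \<union> D \<union> B" "F \<union> A \<union> E = F \<union> E \<union> A"
    using ground by auto
  moreover have "{ground M, A \<union> B \<union> D \<union> E, C \<union> B \<union> E, C \<union> A \<union> D, F \<union> D \<union> B, F \<union> E \<union> A, {}} =
    {ground M, A \<union> B \<union> D \<union> E, C \<union> B \<union> E, C \<union> A \<union> D, F \<union> E \<union> A, F \<union> D \<union> B, {}}"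
    by (simp add: insert_commute)
  ultimately show "is_M_beta k D E C A B F M"
    using is_M_beta assms unfolding is_M_beta_def by metis
qed

lemma base_orderable_below_k: "M \<in> base_orderable (k - 1)"
  unfolding base_orderable_def
proof (intro CollectI conjI ballI)
  fix B1 B2 assume B: "B1 \<in> bases M" "B2 \<in> bases M"
  have both: "\<exists>\<sigma>. exchange_ordering (k - 1) M B1 B2 \<sigma>"
    if "{B1, B2} = {P, Q}" "\<exists>\<sigma>. exchange_ordering (k - 1) M P Q \<sigma>" for P Q
    using that exchange_ordering_inverse by (metis doubleton_eq_iff)
  from ordering_or_exceptional_pair[OF B]
  show "\<exists>\<sigma>. exchange_ordering (k - 1) M B1 B2 \<sigma>"
  proof (elim disjE conjE)
    assume "\<exists>\<sigma>. strong_ordering M B1 B2 \<sigma>"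
    then show ?thesis using strong_ordering_exchange by blast
  next
    assume "{B1, B2} = {A \<union> B \<union> C, D \<union> E \<union> F}"
    then show ?thesis by (rule both[OF _ exceptional_pair_small_ordering])
  next
    assume sizes: "card A = card B" "card B = card D" "card D = card E"
      and pair: "{B1, B2} = {D \<union> E \<union> C, A \<union> B \<union> F}"
    show ?thesis
      using both[OF pair] M_beta.exceptional_pair_small_ordering[OF swap_halves[OF sizes]] .
  qed
qed (rule matroid_axioms)

lemma unorderable_pairs_eq:
  "unorderable_pairs k M = {{A \<union> B \<union> C, D \<union> E \<union> F}} \<union>
    (if card A = card B \<and> card B = card D \<and> card D = card E
     then {{D \<union> E \<union> C, A \<union> B \<union> F}} else {})"
  (is "_ = ?R")
proof
  show "unorderable_pairs k M \<subseteq> ?R"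
  proof
    fix p assume "p \<in> unorderable_pairs k M"
    then obtain B1 B2 where p: "p = {B1, B2}" "B1 \<in> bases M" "B2 \<in> bases M"
      "\<not> (\<exists>\<sigma>. exchange_ordering k M B1 B2 \<sigma>)"
      unfolding unorderable_pairs_def by blast
    then have "\<not> (\<exists>\<sigma>. strong_ordering M B1 B2 \<sigma>)" using strong_ordering_exchange by blast
    then have "{B1, B2} = {A \<union> B \<union> C, D \<union> E \<union> F} \<or>
        card A = card B \<and> card B = card D \<and> card D = card E \<and> {B1, B2} = {D \<union> E \<union> C, A \<union> B \<union> F}"
      using ordering_or_exceptional_pair[OF p(2,3)] by (elim disjE) simp_all
    then show "p \<in> ?R" unfolding p(1) by (elim disjE conjE) simp_all
  qed
next
  have "{A \<union> B \<union> C, D \<union> E \<union> F} \<in> unorderable_pairs k M"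
    unfolding unorderable_pairs_def
    using exceptional_bases exceptional_pair_no_ordering by blast
  moreover have "{D \<union> E \<union> C, A \<union> B \<union> F} \<in> unorderable_pairs k M"
    if "card A = card B" "card B = card D" "card D = card E"
  proof -
    note swapped = swap_halves[OF that]
    show ?thesis
      unfolding unorderable_pairs_def
      using M_beta.exceptional_bases[OF swapped] M_beta.exceptional_pair_no_ordering[OF swapped]
      by blast
  qed
  ultimately show "?R \<subseteq> unorderable_pairs k M" by simp
qed

lemma not_base_orderable: "M \<notin> base_orderable k"
  using exceptional_bases exceptional_pair_no_ordering unfolding base_orderable_def by blast

lemma proper_minor_strongly_base_orderable:
  assumes "proper_minor N M"
  shows "N \<in> strongly_base_orderable"
proof (rule minor_strongly_base_orderable[OF matroid_axioms assms])
  fix B1 B2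
  assume B: "B1 \<in> bases M" "B2 \<in> bases M" and not_partition: "B1 \<inter> B2 \<noteq> {} \<or> B1 \<union> B2 \<noteq> ground M"
  have ne: "{B1, B2} \<noteq> {P, Q}" if "P \<inter> Q = {}" "P \<union> Q = ground M" for P Q
  proof
    assume "{B1, B2} = {P, Q}"
    then have "B1 \<inter> B2 = P \<inter> Q" "B1 \<union> B2 = P \<union> Q" by (auto simp: doubleton_eq_iff)
    then show False using not_partition that by simp
  qed
  have "{B1, B2} \<noteq> {A \<union> B \<union> C, D \<union> E \<union> F}"
    by (rule ne) (simp add: Int_Un_distrib Int_Un_distrib2, use ground in blast)
  moreover have "{B1, B2} \<noteq> {D \<union> E \<union> C, A \<union> B \<union> F}"
    by (rule ne) (simp add: Int_Un_distrib Int_Un_distrib2, use ground in blast)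
  ultimately show "\<exists>\<sigma>. strong_ordering M B1 B2 \<sigma>"
    using ordering_or_exceptional_pair[OF B] by (elim disjE conjE) simp_all
qed

lemma card_unorderable_pairs:
  "card (unorderable_pairs k M) =
    (if card A = card B \<and> card B = card D \<and> card D = card E then 2 else 1)"
proof -
  have ne: "{A \<union> B \<union> C, D \<union> E \<union> F} \<noteq> {D \<union> E \<union> C, A \<union> B \<union> F}"
  proof
    assume eq: "{A \<union> B \<union> C, D \<union> E \<union> F} = {D \<union> E \<union> C, A \<union> B \<union> F}"
    then have "A \<union> B \<union> C = D \<union> E \<union> C \<or> A \<union> B \<union> C = A \<union> B \<union> F" by (auto simp: doubleton_eq_iff)
    then have "(A \<union> B \<union> C) \<inter> A = (D \<union> E \<union> C) \<inter> A \<or> (A \<union> B \<union> C) \<inter> C = (A \<union> B \<union> F) \<inter> C" by auto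
    then have "A = {} \<or> C = {}" by (simp add: Int_Un_distrib2)
    then show False using tuple by (auto simp: beta_tuple_def)
  qed
  then show ?thesis unfolding unorderable_pairs_eq by simp
qed

end

theorem theorem9p3:
  fixes k :: nat and A B C D E F :: "'a set" and M :: "'a matroid_data"
  assumes "k \<ge> 2"
    and "beta_tuple k A B C D E F"
    and "is_M_beta k A B C D E F M"
  shows "(M \<notin> base_orderable k \<and> M \<notin> strongly_base_orderable) \<and>
    (\<forall>x \<in> ground M. transversal (contract M {x})) \<and>
    (excluded_minor strongly_base_orderable M \<and> excluded_minor (base_orderable k) M) \<and>
    M \<in> base_orderable (k - 1) \<and>
    (if real (card A) = k / 2 \<and> real (card B) = k / 2 \<and> real (card D) = k / 2 \<and> real (card E) = k / 2
     then card (unorderable_pairs k M) = 2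
     else card (unorderable_pairs k M) = 1)"
proof -
  have M: "M_beta k A B C D E F M" using assms(2,3) by (simp add: M_beta_def)
  have not_strong: "M \<notin> strongly_base_orderable"
    using M_beta.not_base_orderable[OF M] strongly_base_orderable_imp_base_orderable by blast
  have transversal: "transversal (contract M {x})" if x: "x \<in> ground M" for x
  proof -
    obtain Ss where "presents Ss (contract M {x})" using M_beta.contract_presentation[OF M x] .
    then show ?thesis unfolding presents_def by (intro transversalI[of Ss]) blast+
  qed
  have minor: "N \<in> strongly_base_orderable \<and> N \<in> base_orderable k" if "proper_minor N M" for N
    using M_beta.proper_minor_strongly_base_orderable[OF M that]
      strongly_base_orderable_imp_base_orderable
    by blast
  have "(real (card A) = k / 2 \<and> real (card B) = k / 2 \<and> real (card D) = k / 2 \<and> real (card E) = k / 2)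
    \<longleftrightarrow> card A = card B \<and> card B = card D \<and> card D = card E"
    using M_beta.class_sizes(1,2)[OF M] by auto
  then show ?thesis
    using M_beta.not_base_orderable[OF M] not_strong transversal minor assms(3)
      M_beta.base_orderable_below_k[OF M] M_beta.card_unorderable_pairs[OF M]
    by (simp add: excluded_minor_def is_M_beta_def)
qed

end
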